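(* For every prime $p<200000$, $\mathscr{A}(p)=\mathscr{B}(p)$.
   Context: Let $p$ be a prime. For an integer $r\ge 2$ let $x_1,\ldots,x_r$ be independent indeterminates over $\mathbb{F}_p$ and $f(x)=(x-x_1)\cdots(x-x_r)\in\mathbb{F}_p[x_1,\ldots,x_r][x]$. For integers $e\ge 0$ and $0\le d\le p$ write $f(x)^e=\sum_{i\ge0}c_ix^i$ (with $c_i=0$ for $i<0$) and let $M_d(f(x)^e)$ be the $d\times d$ matrix whose $(i,j)$ entry is $c_{ip+j-d-1}$. Put $\delta(x_1,\ldots,x_r)=\prod_{1\le i<j\le r}(x_i-x_j)$. $\mathscr{A}(p)$ is the set of integer triples $(r,e,d)$ with $r\ge2$, $e\ge1$, $1\le d\le p$, such that $\det M_d(f(x)^e)=\varepsilon\,\delta(x_1,\ldots,x_r)^g$ for some $\varepsilon\in\mathbb{F}_p^{\times}$ and some positive integer $g$. $\mathscr{B}(p)=\mathscr{B}_+(p)\cup\mathscr{B}_0(p)\cup\mathscr{B}_-(p)$ where $\mathscr{B}_+(p)=\{(r,e,d): 2\le r\le p,\ e=p-1,\ d=r\}$, $\mathscr{B}_0(p)=\{(r,e,d): 2\le r\le p+1,\ (p-1)/2<e\le p-1,\ r(p-1-e)\le p-1,\ d=r-1\}$, $\mathscr{B}_-(p)=\{(r,e,d): r\ge2,\ (p-1)/2<e\le p-1,\ r(p-1-e)=p-1,\ d=r-2\}$ (integer triples). *)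

theory Defs
  imports "HOL-Library.Poly_Mapping" "HOL-Computational_Algebra.Polynomial"
    "Jordan_Normal_Form.Determinant" "Berlekamp_Zassenhaus.Finite_Field"
begin

(* Multivariate polynomials over 'a in the indeterminates x_0, x_1, ... :
   finitely supported maps from monomials (exponent vectors nat =>0 nat) to coefficients. *)
type_synonym 'a mpoly = "(nat \<Rightarrow>\<^sub>0 nat) \<Rightarrow>\<^sub>0 'a"

definition Var :: "nat \<Rightarrow> 'a::comm_ring_1 mpoly" where
  "Var i = Poly_Mapping.single (Poly_Mapping.single i 1) 1"

definition Const :: "'a::comm_ring_1 \<Rightarrow> 'a mpoly" where
  "Const c = Poly_Mapping.single 0 c"

definition fpoly :: "nat \<Rightarrow> 'a::comm_ring_1 mpoly poly" where
  "fpoly r = (\<Prod>i<r. [: - Var i, 1 :])"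

definition cf :: "'a::comm_ring_1 mpoly poly \<Rightarrow> int \<Rightarrow> 'a mpoly" where
  "cf F k = (if k < 0 then 0 else Polynomial.coeff F (nat k))"

(* M_d(F): d x d matrix whose (i,j) entry (1-based) is c_{ip+j-d-1};
   here rows/cols are 0-based, i = i'+1, j = j'+1 *)
definition Mmat :: "nat \<Rightarrow> nat \<Rightarrow> 'a::comm_ring_1 mpoly poly \<Rightarrow> 'a mpoly mat" where
  "Mmat p d F = mat d d (\<lambda>(i, j). cf F (int (i + 1) * int p + int (j + 1) - int d - 1))"

definition delta :: "nat \<Rightarrow> 'a::comm_ring_1 mpoly" where
  "delta r = (\<Prod>i<r. \<Prod>j\<in>{i<..<r}. (Var i - Var j))"

definition A_set :: "('p::prime_card) itself \<Rightarrow> (nat \<times> nat \<times> nat) set" where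
  "A_set _ = {(r, e, d). r \<ge> 2 \<and> e \<ge> 1 \<and> 1 \<le> d \<and> d \<le> CARD('p) \<and>
      (\<exists>\<epsilon>::'p mod_ring. \<epsilon> \<noteq> 0 \<and> (\<exists>g::nat. g > 0 \<and>
         det (Mmat CARD('p) d ((fpoly r :: 'p mod_ring mpoly poly) ^ e))
           = Const \<epsilon> * delta r ^ g))}"

definition B_plus :: "nat \<Rightarrow> (nat \<times> nat \<times> nat) set" where
  "B_plus p = {(r, e, d). 2 \<le> r \<and> r \<le> p \<and> int e = int p - 1 \<and> d = r}"

definition B_zero :: "nat \<Rightarrow> (nat \<times> nat \<times> nat) set" where
  "B_zero p = {(r, e, d). 2 \<le> r \<and> r \<le> p + 1 \<and> int p - 1 < 2 * int e \<and> int e \<le> int p - 1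
      \<and> int r * (int p - 1 - int e) \<le> int p - 1 \<and> int d = int r - 1}"

definition B_minus :: "nat \<Rightarrow> (nat \<times> nat \<times> nat) set" where
  "B_minus p = {(r, e, d). 2 \<le> r \<and> int p - 1 < 2 * int e \<and> int e \<le> int p - 1
      \<and> int r * (int p - 1 - int e) = int p - 1 \<and> int d = int r - 2}"

definition B_set :: "nat \<Rightarrow> (nat \<times> nat \<times> nat) set" where
  "B_set p = B_plus p \<union> B_zero p \<union> B_minus p"

end

theory Submission
  imports Defs
begin

text \<open>
  Write \<open>q = p - 1\<close> and \<open>D = det M_d(f ^ e)\<close>. The matrix \<open>M_d(F)\<close> represents the Cartier operator
  \<open>h \<mapsto> C(h F)\<close>, that is, it lists the coefficients of \<open>h F\<close> at \<open>x ^ (i p - 1)\<close>, for \<open>deg h < d\<close>.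
  Suppose \<open>e \<le> q\<close> and \<open>d q \<le> r e \<le> (d + 1) q\<close>. Letting roots collide one after the other shows that \<open>D \<noteq> 0\<close> and that \<open>D\<close> vanishes to order exactly
  \<open>max 0 (2 e - q)\<close> along each diagonal \<open>x_i = x_j\<close>. Moreover \<open>D\<close> is homogeneous of degree
  \<open>d r e - q d (d + 1) / 2\<close>.

  If \<open>D = \<epsilon> \<delta> ^ g\<close>, then \<open>e \<le> q\<close> (otherwise \<open>x_1\<close> divides \<open>D\<close>), \<open>d q \<le> r e\<close> (otherwise the last row is
  zero), and comparing the degree in \<open>x_1\<close> with the total degree gives \<open>r e \<le> (d + 1) q\<close>. Comparing
  total degrees with \<open>g \<le> 2 e - q\<close> yields \<open>(r - 1 - d) (2 r e - q (r + d)) \<ge> 0\<close>, which leaves only the three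
  families of \<open>B_set\<close>. Conversely, for these families \<open>\<delta> ^ (2 e - q)\<close> divides \<open>D\<close>, by translation invariance
  of \<open>D\<close> and a look at the first row when one of the two roots is \<open>0\<close>, and both have the same
  degree.
\<close>

hide_const (open) up_ring.coeff up_ring.monom

section \<open>Evaluation of multivariate polynomials\<close>

lemma sum_single_lookup: "(\<Sum>k\<in>Poly_Mapping.keys f. Poly_Mapping.single k (Poly_Mapping.lookup f k)) = f"
  by (rule poly_mapping_eqI) (auto simp: lookup_sum lookup_single when_def in_keys_iff)

lemma poly_mapping_add_induct [case_names zero single add]:
  assumes "P 0" "\<And>m a. P (Poly_Mapping.single m a)" "\<And>f g. P f \<Longrightarrow> P g \<Longrightarrow> P (f + g)"
  shows "P (f :: _ \<Rightarrow>\<^sub>0 _::comm_monoid_add)"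
proof -
  have "P (\<Sum>k\<in>A. Poly_Mapping.single k (Poly_Mapping.lookup f k))" if "finite A" for A
    using that by (induction A) (auto intro: assms)
  from this[OF finite_keys[of f]] show ?thesis
    by (simp add: sum_single_lookup)
qed

definition monom_ev :: "(nat \<Rightarrow> 'b::comm_ring_1) \<Rightarrow> (nat \<Rightarrow>\<^sub>0 nat) \<Rightarrow> 'b" where
  "monom_ev s m = (\<Prod>i\<in>Poly_Mapping.keys m. s i ^ Poly_Mapping.lookup m i)"

text \<open>The substitution homomorphism behind all later specialisations. The target ring is left
  open so that it can itself be a polynomial ring, with room for a grading variable or a moving
  root.\<close>

definition ev :: "('a::comm_ring_1 \<Rightarrow> 'b::comm_ring_1) \<Rightarrow> (nat \<Rightarrow> 'b) \<Rightarrow> 'a mpoly \<Rightarrow> 'b" where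
  "ev c s P = (\<Sum>m\<in>Poly_Mapping.keys P. c (Poly_Mapping.lookup P m) * monom_ev s m)"

lemma monom_ev_superset:
  assumes "finite A" "Poly_Mapping.keys m \<subseteq> A"
  shows "monom_ev s m = (\<Prod>i\<in>A. s i ^ Poly_Mapping.lookup m i)"
  unfolding monom_ev_def using assms
  by (intro prod.mono_neutral_left) (auto simp: in_keys_iff)

lemma monom_ev_add: "monom_ev s (m + n) = monom_ev s m * monom_ev s n"
proof -
  have "Poly_Mapping.keys (m + n) \<subseteq> Poly_Mapping.keys m \<union> Poly_Mapping.keys n"
    by (rule keys_add)
  then show ?thesis
    by (simp add: monom_ev_superset[of "Poly_Mapping.keys m \<union> Poly_Mapping.keys n"] lookup_add power_add prod.distrib)
qed

lemma monom_ev_0 [simp]: "monom_ev s 0 = 1"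
  by (simp add: monom_ev_def)

lemma comm_ring_hom_ev:
  assumes "comm_ring_hom c"
  shows "comm_ring_hom (ev c s)"
proof -
  interpret c: comm_ring_hom c by fact
  have add: "ev c s (P + Q) = ev c s P + ev c s Q" for P Q
    unfolding ev_def
    by (rule setsum_keys_plus_distrib) (simp_all add: c.hom_add algebra_simps)
  have single: "ev c s (Poly_Mapping.single m a) = c a * monom_ev s m" for m a
    by (simp add: ev_def)
  have zero: "ev c s 0 = 0"
    by (simp add: ev_def)
  have "ev c s (Poly_Mapping.single m a * Q) = ev c s (Poly_Mapping.single m a) * ev c s Q" for m a Q
    by (induction Q rule: poly_mapping_add_induct)
       (simp_all add: zero add single mult_single c.hom_mult monom_ev_add algebra_simps)
  then have mult: "ev c s (P * Q) = ev c s P * ev c s Q" for P Q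
    by (induction P rule: poly_mapping_add_induct)
       (simp_all add: zero add algebra_simps)
  have "ev c s 1 = 1"
    using single[of 0 1] by simp
  then show ?thesis
    by unfold_locales (simp_all add: add mult zero)
qed

lemma ev_Var: "comm_ring_hom c \<Longrightarrow> ev c s (Var i) = s i"
proof -
  assume "comm_ring_hom c"
  then interpret c: comm_ring_hom c .
  show ?thesis by (simp add: ev_def Var_def monom_ev_def)
qed

lemma ev_Const: "comm_ring_hom c \<Longrightarrow> ev c s (Const a) = c a"
proof -
  assume "comm_ring_hom c"
  then interpret c: comm_ring_hom c .
  show ?thesis by (simp add: ev_def Const_def)
qed

lemma comm_ring_hom_Const: "comm_ring_hom (Const :: 'a::comm_ring_1 \<Rightarrow> 'a mpoly)"
  by unfold_locales (simp_all add: Const_def single_add mult_single)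

lemma comm_ring_hom_const_poly: "comm_ring_hom (\<lambda>c::'a::comm_ring_1. [:c:])"
  by unfold_locales (simp_all add: one_pCons)

lemma comm_ring_hom_compose:
  assumes "comm_ring_hom f" "comm_ring_hom g"
  shows "comm_ring_hom (\<lambda>x. g (f x))"
proof -
  interpret f: comm_ring_hom f by fact
  interpret g: comm_ring_hom g by fact
  show ?thesis
    by unfold_locales (simp_all add: f.hom_add f.hom_mult g.hom_add g.hom_mult)
qed

lemma ev_Const_Var: "ev Const Var P = P"
proof -
  have power: "Var i ^ n = Poly_Mapping.single (Poly_Mapping.single i n) (1::'a)" for i n
    by (induction n) (simp_all add: Var_def mult_single flip: single_add)
  have "(\<Prod>i\<in>A. Var i ^ Poly_Mapping.lookup m i) =
      Poly_Mapping.single (\<Sum>i\<in>A. Poly_Mapping.single i (Poly_Mapping.lookup m i)) (1::'a)"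
    if "finite A" for A and m :: "nat \<Rightarrow>\<^sub>0 nat"
    using that by (induction A) (simp_all add: power mult_single)
  then have "monom_ev Var m = Poly_Mapping.single m (1::'a)" for m
    by (simp add: monom_ev_def sum_single_lookup)
  then show ?thesis
    by (simp add: ev_def Const_def mult_single sum_single_lookup)
qed

section \<open>Differences of indeterminates as prime elements\<close>

lemma dvd_prod_diff:
  fixes f g :: "'i \<Rightarrow> 'a::comm_ring_1"
  assumes "\<And>i. i \<in> A \<Longrightarrow> d dvd f i - g i"
  shows "d dvd (\<Prod>i\<in>A. f i) - (\<Prod>i\<in>A. g i)"
  using assms
proof (induction A rule: infinite_finite_induct)
  case (insert x A)
  have "(\<Prod>i\<in>insert x A. f i) - (\<Prod>i\<in>insert x A. g i) =
      (f x - g x) * prod f A + g x * (prod f A - prod g A)"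
    using insert.hyps by (simp add: algebra_simps)
  then show ?case
    using insert by (simp add: dvd_add dvd_mult dvd_mult2)
qed auto

lemma dvd_ev_diff:
  assumes "\<And>i. d dvd s i - t i"
  shows "d dvd ev c s P - ev c t P"
proof -
  have "d dvd monom_ev s m - monom_ev t m" for m
  proof -
    have "d dvd (\<Prod>j<k. s i) - (\<Prod>j<k. t i)" for i and k :: nat
      by (rule dvd_prod_diff) (rule assms)
    then show ?thesis
      unfolding monom_ev_def by (intro dvd_prod_diff) simp
  qed
  then show ?thesis
    by (auto simp: ev_def simp flip: sum_subtractf right_diff_distrib intro!: dvd_sum)
qed

text \<open>Substituting x_j for x_i changes a polynomial only by a multiple of x_i - x_j, so these
  multiples form the kernel. The target is a domain, so the kernel is a prime ideal.\<close>

lemma prime_elem_Var_diff: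
  fixes i j :: nat
  assumes "i \<noteq> j"
  shows "prime_elem (Var i - Var j :: 'a::idom mpoly)"
proof -
  define s where "s = (\<lambda>k. if k = i then Var j else Var k :: 'a mpoly)"
  interpret h: comm_ring_hom "ev Const s"
    by (intro comm_ring_hom_ev comm_ring_hom_Const)
  note [simp] = ev_Var[OF comm_ring_hom_Const]
  have kernel: "Var i - Var j dvd P \<longleftrightarrow> ev Const s P = 0" for P :: "'a mpoly"
  proof
    assume "Var i - Var j dvd P"
    then obtain Q where "P = (Var i - Var j) * Q" by blast
    then show "ev Const s P = 0"
      using assms by (simp add: h.hom_mult h.hom_minus) (simp add: s_def)
  next
    assume *: "ev Const s P = 0"
    have "Var i - Var j dvd ev Const Var P - ev Const s P"
      by (rule dvd_ev_diff) (simp add: s_def)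
    with * show "Var i - Var j dvd P"
      by (simp add: ev_Const_Var)
  qed
  show ?thesis
  proof (rule prime_elemI)
    have "Poly_Mapping.single j 1 \<noteq> Poly_Mapping.single i (1::nat)"
      using assms by (auto dest: arg_cong[of _ _ Poly_Mapping.keys])
    then have "Poly_Mapping.lookup (Var i - Var j :: 'a mpoly) (Poly_Mapping.single i 1) = 1"
      by (simp add: Var_def lookup_minus lookup_single when_def)
    then show "Var i - Var j \<noteq> (0 :: 'a mpoly)"
      by (metis lookup_zero zero_neq_one)
    show "\<not> Var i - Var j dvd (1 :: 'a mpoly)"
      unfolding kernel by simp
  qed (auto simp: kernel h.hom_mult)
qed

text \<open>Substituting x_j for x_i kills the first difference but turns the second into a
  difference of distinct indeterminates. The orderings exclude the pair (j, i), which would only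
  change the sign.\<close>

lemma not_Var_diff_dvd_Var_diff:
  fixes i j k l :: nat
  assumes "i < j" "k < l" "(i, j) \<noteq> (k, l)"
  shows "\<not> (Var i - Var j :: 'a::idom mpoly) dvd Var k - Var l"
proof
  assume "(Var i - Var j :: 'a mpoly) dvd Var k - Var l"
  then obtain Q where Q: "(Var k - Var l :: 'a mpoly) = (Var i - Var j) * Q" by blast
  define s where "s = (\<lambda>n. if n = i then Var j else Var n :: 'a mpoly)"
  interpret h: comm_ring_hom "ev Const s"
    by (intro comm_ring_hom_ev comm_ring_hom_Const)
  note [simp] = ev_Var[OF comm_ring_hom_Const]
  have "s k - s l = 0"
    using arg_cong[OF Q, of "ev Const s"] assms(1) by (simp add: h.hom_mult h.hom_minus) (simp add: s_def)
  moreover have "s k - s l = Var k' - Var l'" if "k' = (if k = i then j else k)"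
      "l' = (if l = i then j else l)" for k' l'
    using that by (auto simp: s_def)
  moreover have "(if k = i then j else k) \<noteq> (if l = i then j else l)"
    using assms by auto
  ultimately show False
    using prime_elem_Var_diff prime_elem_not_zeroI by metis
qed

lemma prime_elem_power_dvd_mult_cancel:
  fixes b :: "'a::idom"
  assumes "prime_elem b" "\<not> b dvd a" "b ^ n dvd a * Q"
  shows "b ^ n dvd Q"
  using assms(3)
proof (induction n arbitrary: Q)
  case (Suc n)
  have "b dvd a * Q"
    using Suc.prems by (metis dvd_mult_left power_Suc)
  with assms obtain Q' where Q': "Q = b * Q'"
    by (auto simp: prime_elem_dvd_mult_iff)
  have "b * b ^ n dvd b * (a * Q')"
    using Suc.prems Q' by (simp add: mult.left_commute)
  then have "b ^ n dvd a * Q'"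
    using assms(1) by (simp add: prime_elem_def)
  from Suc.IH[OF this] Q' show ?case by (simp add: mult_dvd_mono)
qed auto

text \<open>Induction on \<open>A\<close>: the prime \<open>f x\<close> divides none of the other
  factors, hence not their product, so its \<open>n\<close>-th power must divide the
  cofactor.\<close>

lemma prod_prime_elem_power_dvd:
  fixes f :: "'i \<Rightarrow> 'a::idom"
  assumes "finite A" "\<And>i. i \<in> A \<Longrightarrow> prime_elem (f i)"
    "\<And>i j. i \<in> A \<Longrightarrow> j \<in> A \<Longrightarrow> i \<noteq> j \<Longrightarrow> \<not> f i dvd f j"
    "\<And>i. i \<in> A \<Longrightarrow> f i ^ n dvd P"
  shows "(\<Prod>i\<in>A. f i) ^ n dvd P"
  using assms
proof (induction A)
  case (insert x A)
  then obtain Q where Q: "P = (\<Prod>i\<in>A. f i) ^ n * Q" by auto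
  have "\<not> f x dvd (\<Prod>i\<in>A. f i) ^ n"
  proof
    assume "f x dvd (\<Prod>i\<in>A. f i) ^ n"
    then have "f x dvd (\<Prod>i\<in>A. f i)"
      using insert.prems(1) prime_elem_dvd_power by blast
    moreover have "\<not> f x dvd (\<Prod>i\<in>B. f i)" if "B \<subseteq> A" for B
      using that insert.prems(1,2) insert.hyps(2)
    proof (induction B rule: infinite_finite_induct)
      case (insert y B)
      then have "\<not> f x dvd f y" "\<not> f x dvd (\<Prod>i\<in>B. f i)" by auto
      with insert show ?case by (simp add: prime_elem_dvd_mult_iff)
    qed (auto simp: prime_elem_not_unit)
    ultimately show False by blast
  qed
  then have "f x ^ n dvd Q"
    using insert.prems(1,3) Q by (metis insertI1 prime_elem_power_dvd_mult_cancel)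
  then obtain Q' where "Q = f x ^ n * Q'" by blast
  moreover have "(f x * (\<Prod>i\<in>A. f i)) ^ n * Q' = (\<Prod>i\<in>A. f i) ^ n * (f x ^ n * Q')"
    by (simp only: power_mult_distrib mult.assoc mult.left_commute)
  ultimately have "P = (\<Prod>i\<in>insert x A. f i) ^ n * Q'"
    using Q by (simp only: prod.insert[OF insert.hyps(1,2)])
  then show ?case by simp
qed auto

section \<open>The product of all root differences\<close>

definition pairs :: "nat \<Rightarrow> (nat \<times> nat) set" where
  "pairs r = (SIGMA i:{..<r}. {i<..<r})"

lemma finite_pairs [simp]: "finite (pairs r)"
  by (simp add: pairs_def)

lemma delta_eq_prod_pairs: "delta r = (\<Prod>(i, j)\<in>pairs r. Var i - Var j)"
  by (simp add: delta_def pairs_def prod.Sigma)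

lemma delta_power_dvd:
  fixes P :: "'a::idom mpoly"
  assumes "\<And>i j. i < j \<Longrightarrow> j < r \<Longrightarrow> (Var i - Var j) ^ n dvd P"
  shows "delta r ^ n dvd P"
  unfolding delta_eq_prod_pairs
proof (rule prod_prime_elem_power_dvd)
  fix x y assume "x \<in> pairs r" "y \<in> pairs r" "x \<noteq> y"
  then show "\<not> (case x of (i, j) \<Rightarrow> Var i - Var j) dvd (case y of (i, j) \<Rightarrow> (Var i - Var j :: 'a mpoly))"
    using not_Var_diff_dvd_Var_diff[of "fst x" "snd x" "fst y" "snd y", where 'a = 'a]
    by (auto simp: pairs_def)
qed (use assms in \<open>auto simp: pairs_def prime_elem_Var_diff\<close>)

lemma Var_diff_neq_0: "i \<noteq> j \<Longrightarrow> Var i - Var j \<noteq> (0 :: 'a::idom mpoly)"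
  by (metis prime_elem_Var_diff prime_elem_not_zeroI)

lemma delta_neq_0: "delta r \<noteq> (0 :: 'a::idom mpoly)"
proof -
  have "(case x of (i, j) \<Rightarrow> (Var i - Var j :: 'a mpoly)) \<noteq> 0" if "x \<in> pairs r" for x
    using that unfolding case_prod_unfold by (intro Var_diff_neq_0) (auto simp: pairs_def)
  then show ?thesis
    unfolding delta_eq_prod_pairs prod_zero_iff[OF finite_pairs] by blast
qed

lemma ev_delta:
  assumes "comm_ring_hom c"
  shows "ev c s (delta r) = (\<Prod>(i, j)\<in>pairs r. s i - s j)"
proof -
  interpret h: comm_ring_hom "ev c s"
    using assms by (rule comm_ring_hom_ev)
  show ?thesis
    by (simp add: delta_eq_prod_pairs h.hom_prod case_prod_unfold h.hom_minus ev_Var[OF assms])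
qed

lemma card_pairs: "2 * card (pairs r) = r * (r - 1)"
proof (induction r)
  case (Suc r)
  have "pairs (Suc r) = pairs r \<union> (\<lambda>i. (i, r)) ` {..<r}"
    by (auto simp: pairs_def)
  moreover have "pairs r \<inter> (\<lambda>i. (i, r)) ` {..<r} = {}"
    by (auto simp: pairs_def)
  ultimately have "card (pairs (Suc r)) = card (pairs r) + r"
    by (simp add: card_Un_disjoint card_image inj_on_def)
  with Suc show ?case by (cases r) (auto simp: algebra_simps)
qed (simp add: pairs_def)

section \<open>The matrix of the Cartier operator\<close>

text \<open>Column \<open>j\<close> lists the coefficients of \<open>x ^ (d - 1 - j) * F\<close> at \<open>x ^ (i p - 1)\<close>, \<open>1 \<le> i \<le> d\<close>. Writing
  \<open>M_d(F)\<close> in this way avoids negative indices.\<close>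

definition cmat :: "nat \<Rightarrow> nat \<Rightarrow> 'a::comm_ring_1 poly \<Rightarrow> 'a mat" where
  "cmat p d F = mat d d (\<lambda>(i, j). coeff (monom 1 (d - 1 - j) * F) (Suc i * p - 1))"

lemma cmat_carrier [simp]: "cmat p d F \<in> carrier_mat d d"
  by (simp add: cmat_def)

lemma cmat_dim [simp]: "dim_row (cmat p d F) = d" "dim_col (cmat p d F) = d"
  by (simp_all add: cmat_def)

lemma cmat_index:
  "i < d \<Longrightarrow> j < d \<Longrightarrow> cmat p d F $$ (i, j) = coeff (monom 1 (d - 1 - j) * F) (Suc i * p - 1)"
  by (simp add: cmat_def)

text \<open>For n < m both sides vanish, so multiplication by a monomial reproduces the convention
  for negative indices.\<close>

lemma cf_diff: "cf F (int n - int m) = coeff (monom 1 m * F) n"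
  by (auto simp: cf_def coeff_monom_mult nat_diff_distrib)

lemma Mmat_eq_cmat:
  assumes "p > 0"
  shows "Mmat p d F = cmat p d F"
proof (rule eq_matI)
  fix i j assume "i < dim_row (cmat p d F)" "j < dim_col (cmat p d F)"
  then have ij: "i < d" "j < d" by simp_all
  define n where "n = Suc i * p - 1"
  have "int (i + 1) * int p = int (Suc i * p)"
    by (simp only: of_nat_mult Suc_eq_plus1)
  also have "Suc i * p = Suc n"
    using assms by (simp add: n_def)
  finally have "int (i + 1) * int p = int n + 1"
    by simp
  then have "int (i + 1) * int p + int (j + 1) - int d - 1 = int n - int (d - 1 - j)"
    using ij by simp
  moreover have "Mmat p d F $$ (i, j) = cf F (int (i + 1) * int p + int (j + 1) - int d - 1)"
    using ij by (simp add: Mmat_def)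
  ultimately show "Mmat p d F $$ (i, j) = cmat p d F $$ (i, j)"
    using ij by (simp only: cf_diff cmat_index n_def)
qed (simp_all add: Mmat_def)

lemma (in comm_ring_hom) hom_monom_mult_coeff:
  "hom (coeff (monom 1 k * F) n) = coeff (monom 1 k * map_poly hom F) n"
  by (simp add: coeff_monom_mult)

lemma (in comm_ring_hom) hom_det_cmat:
  "hom (det (cmat p d F)) = det (cmat p d (map_poly hom F))"
proof -
  have "map_mat hom (cmat p d F) = cmat p d (map_poly hom F)"
    by (rule eq_matI) (auto simp: cmat_def hom_monom_mult_coeff)
  then show ?thesis
    using hom_det[of "cmat p d F"] by simp
qed

lemma (in comm_ring_hom) map_poly_linear_factor: "map_poly hom [:- a, 1:] = [:- hom a, 1:]"
  by (simp add: map_poly_pCons_hom hom_uminus)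

subsection \<open>Invariance under translation\<close>

lemma coeff_pcompose_translate:
  fixes G :: "'a::comm_ring_1 poly"
  assumes "degree G \<le> N"
  shows "coeff (G \<circ>\<^sub>p [:a, 1:]) n = (\<Sum>m\<le>N. coeff G m * of_nat (m choose n) * a ^ (m - n))"
proof -
  have *: "coeff ([:a, 1:] ^ m) n = of_nat (m choose n) * a ^ (m - n)" for m
  proof (cases "n \<le> m")
    case True
    then show ?thesis by (simp add: coeff_linear_poly_power)
  next
    case False
    have "degree ([:a, 1:] ^ m) \<le> m"
      using degree_power_le[of "[:a, 1:]" m] by simp
    with False show ?thesis by (simp add: coeff_eq_0 binomial_eq_0)
  qed
  have "monom c m \<circ>\<^sub>p [:a, 1:] = smult c ([:a, 1:] ^ m)" for c m
    by (induction m) (simp_all add: monom_0 monom_Suc pcompose_pCons)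
  then have "(\<Sum>m\<le>N. monom (coeff G m) m) \<circ>\<^sub>p [:a, 1:] = (\<Sum>m\<le>N. smult (coeff G m) ([:a, 1:] ^ m))"
    by (simp add: pcompose_sum)
  then have "G \<circ>\<^sub>p [:a, 1:] = (\<Sum>m\<le>N. smult (coeff G m) ([:a, 1:] ^ m))"
    by (simp add: poly_as_sum_of_monoms'[OF assms])
  then show ?thesis
    by (simp add: coeff_sum * mult.assoc)
qed

text \<open>Absorption: k p binom(m + 1, k p) = (m + 1) binom(m, k p - 1), and \<open>p\<close> is
  prime to m + 1. So in characteristic \<open>p\<close> a translation carries no other exponent into
  one that is -1 modulo \<open>p\<close>.\<close>

lemma prime_dvd_choose_pred:
  fixes p :: nat
  assumes "prime p" "\<not> p dvd Suc m" "k > 0"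
  shows "p dvd m choose (k * p - 1)"
proof -
  have kp: "k * p \<ge> 1"
    using assms prime_gt_0_nat[of p] by simp
  have "Suc (k * p - 1) * (Suc m choose Suc (k * p - 1)) = Suc m * (m choose (k * p - 1))"
    by (rule Suc_times_binomial)
  moreover have "Suc (k * p - 1) = k * p"
    using kp by simp
  ultimately have "p dvd Suc m * (m choose (k * p - 1))"
    by (metis dvd_mult2 dvd_triv_right)
  then show ?thesis
    using assms(1,2) prime_dvd_multD by blast
qed

text \<open>Exponents that are -1 modulo \<open>p\<close> receive contributions only from exponents
  of the same kind, and the degree bound leaves just the first \<open>d\<close> of these.\<close>

lemma coeff_pcompose_translate_char_p:
  fixes G :: "'a::comm_ring_1 poly"
  assumes "prime p" "of_nat p = (0 :: 'a)" "degree G + 1 < Suc d * p"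
  shows "coeff (G \<circ>\<^sub>p [:a, 1:]) (Suc i * p - 1) =
    (\<Sum>k<d. of_nat ((Suc k * p - 1) choose (Suc i * p - 1)) * a ^ ((Suc k * p - 1) - (Suc i * p - 1)) *
      coeff G (Suc k * p - 1))"
proof -
  define N where "N = Suc d * p - 2"
  have p: "p \<ge> 2" using assms(1) by (rule prime_ge_2_nat)
  have N: "degree G \<le> N" using assms(3) by (simp add: N_def)
  let ?f = "\<lambda>m. coeff G m * of_nat (m choose (Suc i * p - 1)) * a ^ (m - (Suc i * p - 1))"
  have inj: "inj_on (\<lambda>k. Suc k * p - 1) {..<d}"
  proof (rule inj_onI)
    fix k l assume "Suc k * p - 1 = Suc l * p - 1"
    moreover have "Suc k * p \<ge> 1" "Suc l * p \<ge> 1" using p by auto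
    ultimately have "Suc k * p = Suc l * p" by linarith
    with p show "k = l" by simp
  qed
  have "(\<Sum>m\<le>N. ?f m) = (\<Sum>m\<in>(\<lambda>k. Suc k * p - 1) ` {..<d}. ?f m)"
  proof (rule sum.mono_neutral_right)
    show "(\<lambda>k. Suc k * p - 1) ` {..<d} \<subseteq> {..N}"
    proof (rule image_subsetI)
      fix k assume "k \<in> {..<d}"
      then have "Suc k * p \<le> d * p" by (intro mult_le_mono1) simp
      with p show "Suc k * p - 1 \<in> {..N}" by (simp add: N_def)
    qed
    show "\<forall>m\<in>{..N} - (\<lambda>k. Suc k * p - 1) ` {..<d}. ?f m = 0"
    proof
      fix m assume m: "m \<in> {..N} - (\<lambda>k. Suc k * p - 1) ` {..<d}"
      have "\<not> p dvd Suc m"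
      proof
        assume "p dvd Suc m"
        then obtain l where l: "Suc m = p * l" by blast
        then obtain k where k: "l = Suc k" by (cases l) auto
        have "m \<le> p + d * p - 2" using m by (simp add: N_def)
        then have "Suc m < p + d * p" using p by linarith
        then have "p * l < p * Suc d" unfolding l mult_Suc_right mult.commute[of d] .
        then have "k < d" using k by simp
        moreover have "m = Suc k * p - 1" using l k by (simp add: mult.commute)
        ultimately show False using m by blast
      qed
      with assms(1) have "p dvd m choose (Suc i * p - 1)"
        by (intro prime_dvd_choose_pred) auto
      then obtain c where c: "m choose (Suc i * p - 1) = p * c" ..
      show "?f m = 0" unfolding c using assms(2) by simp
    qed
  qed simp
  also have "\<dots> = (\<Sum>k<d. ?f (Suc k * p - 1))"
    using inj by (subst sum.reindex) simp_all
  finally show ?thesis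
    unfolding coeff_pcompose_translate[OF N] by (simp add: mult_ac)
qed

text \<open>Translation acts on the rows through the binomial matrix \<open>U\<close> and on the
  columns through \<open>V\<close>, which expresses powers of x - a by powers of x. Both are
  triangular with ones on the diagonal.\<close>

lemma det_cmat_translate:
  fixes F :: "'a::comm_ring_1 poly"
  assumes p: "prime p" "of_nat p = (0 :: 'a)" and deg: "degree F \<le> Suc d * (p - 1)"
  shows "det (cmat p d (F \<circ>\<^sub>p [:a, 1:])) = det (cmat p d F)"
proof -
  define N where "N k = Suc k * p - 1" for k
  define U where "U = mat d d (\<lambda>(i, k). of_nat (N k choose N i) * a ^ (N k - N i))"
  define V where "V = mat d d (\<lambda>(l, j). coeff ([:-a, 1:] ^ (d - 1 - j)) (d - 1 - l))"
  have UV [simp]: "U \<in> carrier_mat d d" "V \<in> carrier_mat d d"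
    by (simp_all add: U_def V_def)
  have p2: "p \<ge> 2" using p(1) by (rule prime_ge_2_nat)
  have less: "N k < N i" if "k < i" for k i
  proof -
    have "Suc k * p < Suc i * p" "Suc k * p \<ge> 1" using that p2 by auto
    then show ?thesis unfolding N_def by linarith
  qed
  have "det U = 1"
  proof -
    have "det U = prod_list (diag_mat U)"
      by (rule det_upper_triangular[OF upper_triangularI UV(1)]) (auto simp: U_def less binomial_eq_0)
    also have "\<dots> = 1" by (simp add: prod_list_diag_prod U_def)
    finally show ?thesis .
  qed
  moreover have "det V = 1"
  proof -
    have "coeff ([:-a, 1:] ^ (d - 1 - j)) (d - 1 - i) = 0" if "i < j" "j < d" for i j
    proof (rule coeff_eq_0)
      have "degree ([:-a, 1:] ^ (d - 1 - j)) \<le> d - 1 - j"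
        using degree_power_le[of "[:-a, 1:]" "d - 1 - j"] by simp
      with that show "degree ([:-a, 1:] ^ (d - 1 - j)) < d - 1 - i" by linarith
    qed
    then have "det V = prod_list (diag_mat V)"
      by (intro det_lower_triangular[OF _ UV(2)]) (auto simp: V_def)
    also have "\<dots> = 1" by (simp add: prod_list_diag_prod V_def coeff_linear_power)
    finally show ?thesis .
  qed
  moreover have "cmat p d (F \<circ>\<^sub>p [:a, 1:]) = U * (cmat p d F * V)"
  proof (rule eq_matI)
    fix i j assume "i < dim_row (U * (cmat p d F * V))" "j < dim_col (U * (cmat p d F * V))"
    then have ij: "i < d" "j < d" by (simp_all add: U_def V_def)
    define G where "G = [:-a, 1:] ^ (d - 1 - j) * F"
    \<comment> \<open>Since x ^ n is the translate of (x - a) ^ n, the entire column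
      \<open>j\<close> comes from the translate of one polynomial \<open>G\<close>.\<close>
    have monom_translate: "monom 1 n = ([:-a, 1:] ^ n) \<circ>\<^sub>p [:a, 1:]" for n
      by (simp add: pcompose_hom.hom_power pcompose_pCons monom_altdef)
    have "degree G \<le> degree ([:-a, 1:] ^ (d - 1 - j)) + degree F"
      unfolding G_def by (rule degree_mult_le)
    moreover have "degree ([:-a, 1:] ^ (d - 1 - j)) \<le> d - 1 - j"
      using degree_power_le[of "[:-a, 1:]" "d - 1 - j"] by simp
    ultimately have "degree G \<le> (d - 1) + Suc d * (p - 1)"
      using deg by linarith
    \<comment> \<open>There is just enough room: (d - 1) + (d + 1) (p - 1) + 1 = (d + 1) p -
      1.\<close>
    then have "degree G + 1 < Suc d * p"
      using p2 ij by (cases p) auto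
    have FV: "(cmat p d F * V) $$ (k, j) = coeff G (Suc k * p - 1)" if "k < d" for k
    proof -
      have G: "G = (\<Sum>l<d. smult (coeff ([:-a, 1:] ^ (d - 1 - j)) (d - 1 - l)) (monom 1 (d - 1 - l) * F))"
      proof -
        have "degree ([:-a, 1:] ^ (d - 1 - j)) \<le> d - 1"
          using degree_power_le[of "[:-a, 1:]" "d - 1 - j"] by simp
        from poly_as_sum_of_monoms'[OF this]
        have "[:-a, 1:] ^ (d - 1 - j) = (\<Sum>l\<le>d - 1. monom (coeff ([:-a, 1:] ^ (d - 1 - j)) l) l)" ..
        also have "{..d - 1} = {..<d}" using ij by auto
        also have "(\<Sum>l<d. monom (coeff ([:-a, 1:] ^ (d - 1 - j)) l) l) =
            (\<Sum>l<d. monom (coeff ([:-a, 1:] ^ (d - 1 - j)) (d - 1 - l)) (d - 1 - l))"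
          by (subst sum.nat_diff_reindex[symmetric]) simp
        finally have "G = (\<Sum>l<d. monom (coeff ([:-a, 1:] ^ (d - 1 - j)) (d - 1 - l)) (d - 1 - l)) * F"
          unfolding G_def by (rule arg_cong)
        then show ?thesis
          by (simp add: sum_distrib_right smult_monom flip: mult_smult_left)
      qed
      show ?thesis
        using that ij by (subst G) (simp add: scalar_prod_def V_def cmat_def coeff_sum mult.commute atLeast0LessThan)
    qed
    have "cmat p d (F \<circ>\<^sub>p [:a, 1:]) $$ (i, j) = coeff (G \<circ>\<^sub>p [:a, 1:]) (Suc i * p - 1)"
      using ij by (simp add: cmat_def monom_translate G_def pcompose_mult)
    also have "\<dots> = (\<Sum>k<d. U $$ (i, k) * coeff G (Suc k * p - 1))"
      unfolding coeff_pcompose_translate_char_p[OF p \<open>degree G + 1 < Suc d * p\<close>]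
      using ij by (simp add: U_def N_def)
    also have "\<dots> = (U * (cmat p d F * V)) $$ (i, j)"
      using ij FV by (simp add: scalar_prod_def U_def V_def atLeast0LessThan)
    finally show "cmat p d (F \<circ>\<^sub>p [:a, 1:]) $$ (i, j) = (U * (cmat p d F * V)) $$ (i, j)" .
  qed (simp_all add: U_def V_def)
  ultimately show ?thesis
    by (simp add: det_mult[OF UV(1) mult_carrier_mat[OF cmat_carrier UV(2)]] det_mult[OF cmat_carrier UV(2)])
qed

subsection \<open>Collision of two roots\<close>

text \<open>Modulo \<open>x ^ (q - a + 1)\<close>, the power \<open>(x - u) ^ b\<close> is \<open>u ^ (a + b - q)\<close> times \<open>lower_part q a b u\<close>.\<close>

definition lower_part :: "nat \<Rightarrow> nat \<Rightarrow> nat \<Rightarrow> 'a::comm_ring_1 \<Rightarrow> 'a poly" where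
  "lower_part q a b u = (\<Sum>l\<le>q - a. monom (of_nat (b choose l) * (-1) ^ (b - l) * u ^ (q - a - l)) l)"

text \<open>Because of the factor x ^ a, only coefficients of (x - u) ^ b at exponents i \<le> q - a
  contribute, and these contain u ^ (b - i) with b - i \<ge> a + b - q.\<close>

lemma coeff_collision:
  fixes u :: "'a::comm_ring_1"
  assumes "a \<le> q" "b \<le> q" "q \<le> a + b" "k \<le> q"
  shows "coeff (monom 1 a * [:-u, 1:] ^ b * G) k =
    u ^ (a + b - q) * coeff (monom 1 a * lower_part q a b u * G) k"
proof -
  have *: "coeff ([:-u, 1:] ^ b) i = u ^ (a + b - q) * coeff (lower_part q a b u) i" if "i \<le> q - a" for i
  proof -
    have exponent: "b - i = (a + b - q) + (q - a - i)" and "i \<le> b"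
      using that assms by auto
    have "coeff ([:-u, 1:] ^ b) i = of_nat (b choose i) * (- u) ^ (b - i)"
      using \<open>i \<le> b\<close> by (simp add: coeff_linear_poly_power)
    also have "(- u) ^ (b - i) = (- 1) ^ (b - i) * u ^ (b - i)"
      by (rule power_minus)
    also have "u ^ (b - i) = u ^ (a + b - q) * u ^ (q - a - i)"
      unfolding exponent by (rule power_add)
    also have "of_nat (b choose i) * ((- 1) ^ (b - i) * (u ^ (a + b - q) * u ^ (q - a - i))) =
        u ^ (a + b - q) * (of_nat (b choose i) * (-1) ^ (b - i) * u ^ (q - a - i))"
      by (simp only: mult_ac)
    also have "of_nat (b choose i) * (-1) ^ (b - i) * u ^ (q - a - i) = coeff (lower_part q a b u) i"
      using that by (simp add: lower_part_def coeff_sum)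
    finally show ?thesis .
  qed
  show ?thesis
  proof (cases "k < a")
    case False
    then show ?thesis
      using assms * by (simp add: mult.assoc coeff_monom_mult coeff_mult[of _ G] sum_distrib_left)
  qed (simp add: mult.assoc coeff_monom_mult)
qed

text \<open>What remains of \<open>cmat p d F\<close> when a power of \<open>u\<close> is taken out
  of its first row; \<open>H\<close> supplies that row.\<close>

definition collision_mat :: "nat \<Rightarrow> nat \<Rightarrow> 'a::comm_ring_1 poly \<Rightarrow> 'a poly \<Rightarrow> 'a mat" where
  "collision_mat p d H F =
    mat d d (\<lambda>(i, j). coeff (monom 1 (d - 1 - j) * (if i = 0 then H else F)) (Suc i * p - 1))"

lemma det_cmat_collision:
  fixes u :: "'a::comm_ring_1"
  assumes "a \<le> p - 1" "b \<le> p - 1" "p - 1 \<le> a + b" "d > 0"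
  shows "det (cmat p d (monom 1 a * [:-u, 1:] ^ b * G)) = u ^ (a + b - (p - 1)) *
    det (collision_mat p d (monom 1 a * lower_part (p - 1) a b u * G) (monom 1 a * [:-u, 1:] ^ b * G))"
    (is "det (cmat p d ?F) = _ * det ?A")
proof -
  have A: "?A \<in> carrier_mat d d"
    by (simp add: collision_mat_def)
  have row: "coeff (monom 1 (d - 1 - j) * ?F) (p - 1) =
      u ^ (a + b - (p - 1)) * coeff (monom 1 (d - 1 - j) * (monom 1 a * lower_part (p - 1) a b u * G)) (p - 1)" for j
    using coeff_collision[OF assms(1-3), of "p - 1 - (d - 1 - j)" u G] by (simp add: coeff_monom_mult)
  have "cmat p d ?F = multrow 0 (u ^ (a + b - (p - 1))) ?A"
    using row by (intro eq_matI) (auto simp: cmat_def collision_mat_def)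
  then show ?thesis
    using det_multrow[OF assms(4) A] by simp
qed

text \<open>At u = 0 only the top term of \<open>lower_part\<close> survives, so the first row can
  be nonzero only in its last entry. Laplace expansion leaves the matrix of size d - 1 in which the
  root 0 has multiplicity a + b - (p - 1).\<close>

lemma (in comm_ring_hom) hom_det_collision_mat:
  assumes hu: "hom u = 0" and d: "d > 0" and ab: "a \<le> p - 1" "b \<le> p - 1" "p - 1 \<le> a + b" and p: "p > 0"
  shows "hom (det (collision_mat p d (monom 1 a * lower_part (p - 1) a b u * G) (monom 1 a * [:-u, 1:] ^ b * G))) =
    of_nat (b choose (p - 1 - a)) * (-1) ^ (a + b - (p - 1)) * coeff (map_poly hom G) 0 * (-1) ^ (d - 1) *
      det (cmat p (d - 1) (monom 1 (a + b - (p - 1)) * map_poly hom G))"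
    (is "hom (det ?A) = ?c * _ * _ * _ * _")
proof -
  interpret mp: map_poly_comm_ring_hom hom ..
  let ?G = "map_poly hom G"
  let ?c = "of_nat (b choose (p - 1 - a)) * (-1) ^ (a + b - (p - 1)) :: 'b"
  define B where "B = map_mat hom ?A"
  have B: "B \<in> carrier_mat d d" by (simp add: B_def collision_mat_def)
  have lower: "map_poly hom (lower_part (p - 1) a b u) = monom ?c (p - 1 - a)"
  proof -
    have "map_poly hom (lower_part (p - 1) a b u) =
        (\<Sum>l\<le>p - 1 - a. if l = p - 1 - a then monom ?c (p - 1 - a) else 0)"
      unfolding lower_part_def mp.hom_sum
    proof (rule sum.cong[OF refl])
      fix l assume "l \<in> {..p - 1 - a}"
      moreover have "b - (p - 1 - a) = a + b - (p - 1)" using ab by simp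
      ultimately show "map_poly hom (monom (of_nat (b choose l) * (- 1) ^ (b - l) * u ^ (p - 1 - a - l)) l) =
          (if l = p - 1 - a then monom ?c (p - 1 - a) else 0)"
        using hu by (auto simp: hom_distribs power_0_left)
    qed
    then show ?thesis by simp
  qed
  have H: "map_poly hom (monom 1 a * lower_part (p - 1) a b u * G) = monom ?c (p - 1) * ?G"
  proof -
    have "a + (p - Suc a) = p - Suc 0" using ab p by simp
    then show ?thesis unfolding mp.hom_mult lower by (simp add: map_poly_monom mult_monom)
  qed
  have F: "map_poly hom (monom 1 a * [:-u, 1:] ^ b * G) = monom 1 (a + b) * ?G"
  proof -
    have "[:0, 1:] ^ n = monom (1::'b) n" for n by (simp add: monom_altdef)
    then show ?thesis
      by (simp add: mp.hom_mult mp.hom_power map_poly_linear_factor map_poly_monom hu mult_monom)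
  qed
  have index: "B $$ (i, j) = coeff (monom 1 (d - 1 - j) * (if i = 0 then monom ?c (p - 1) * ?G else monom 1 (a + b) * ?G))
      (Suc i * p - 1)" if "i < d" "j < d" for i j
  proof -
    have "B $$ (i, j) = hom (coeff (monom 1 (d - 1 - j) * (if i = 0 then
        monom 1 a * lower_part (p - 1) a b u * G else monom 1 a * [:-u, 1:] ^ b * G)) (Suc i * p - 1))"
      using that by (simp add: B_def collision_mat_def)
    then show ?thesis
      by (simp only: hom_monom_mult_coeff if_distrib[of "map_poly hom"] H F)
  qed
  have row0: "B $$ (0, j) = (if j = d - 1 then ?c * coeff ?G 0 else 0)" if "j < d" for j
    using that d by (auto simp: index coeff_monom_mult)
  have minor: "mat_delete B 0 (d - 1) = cmat p (d - 1) (monom 1 (a + b - (p - 1)) * ?G)"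
  proof (rule eq_matI)
    fix i j assume "i < dim_row (cmat p (d - 1) (monom 1 (a + b - (p - 1)) * ?G))"
      "j < dim_col (cmat p (d - 1) (monom 1 (a + b - (p - 1)) * ?G))"
    then have ij: "i < d - 1" "j < d - 1" by simp_all
    then have "mat_delete B 0 (d - 1) $$ (i, j) = B $$ (Suc i, j)"
      using B by (simp add: mat_delete_def)
    also have "\<dots> = coeff (monom 1 (d - 1 - j + (a + b)) * ?G) (Suc (Suc i) * p - 1)"
      using ij by (simp add: index mult_monom flip: mult.assoc)
    \<comment> \<open>Splitting off x ^ p lowers the exponent that is read by \<open>p\<close>,
      which turns row i + 1 into row i of the smaller matrix.\<close>
    also have "d - 1 - j + (a + b) = p + (d - 1 - 1 - j + (a + b - (p - 1)))"
      using ij ab p by simp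
    also have "coeff (monom 1 \<dots> * ?G) (Suc (Suc i) * p - 1) =
        coeff (monom 1 p * (monom 1 (d - 1 - 1 - j + (a + b - (p - 1))) * ?G)) (Suc (Suc i) * p - 1)"
      by (simp add: mult_monom flip: mult.assoc)
    also have "\<dots> = coeff (monom 1 (d - 1 - 1 - j + (a + b - (p - 1))) * ?G) (Suc i * p - 1)"
    proof -
      have "Suc (Suc i) * p - 1 \<ge> p" "Suc (Suc i) * p - 1 - p = Suc i * p - 1" using p by auto
      then show ?thesis by (simp add: coeff_monom_mult[of 1 p])
    qed
    also have "\<dots> = cmat p (d - 1) (monom 1 (a + b - (p - 1)) * ?G) $$ (i, j)"
      using ij by (simp add: cmat_def mult_monom flip: mult.assoc)
    finally show "mat_delete B 0 (d - 1) $$ (i, j) = \<dots>" .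
  qed (use B in \<open>simp_all add: mat_delete_def\<close>)
  have "hom (det ?A) = det B"
    by (simp add: B_def)
  also have "\<dots> = (\<Sum>j<d. B $$ (0, j) * cofactor B 0 j)"
    using B d by (rule laplace_expansion_row)
  also have "\<dots> = (\<Sum>j<d. if j = d - 1 then ?c * coeff ?G 0 * cofactor B 0 (d - 1) else 0)"
    by (rule sum.cong) (auto simp: row0)
  also have "\<dots> = ?c * coeff ?G 0 * cofactor B 0 (d - 1)"
    using d by simp
  finally show ?thesis
    unfolding cofactor_def minor add_0 by (simp only: mult_ac)
qed

section \<open>One moving root, and nonvanishing by successive collisions\<close>

lemma map_poly_linear_prod:
  assumes "comm_ring_hom h"
  shows "map_poly h (\<Prod>i\<in>A. [:- s i, 1:] ^ e) = (\<Prod>i\<in>A. [:- h (s i), 1:] ^ e)"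
proof -
  interpret comm_ring_hom h by fact
  interpret mp: map_poly_comm_ring_hom h ..
  show ?thesis
    by (simp add: mp.hom_prod mp.hom_power map_poly_linear_factor)
qed

text \<open>The moving root is the polynomial indeterminate, so its positions are the arguments of
  \<open>P\<close>, and argument 0 is the collision with the root 0 of multiplicity
  \<open>a\<close>.\<close>

lemma poly_det_collision_small:
  fixes s :: "nat \<Rightarrow> 'a::comm_ring_1 poly" and p d a b n e :: nat
  defines "P \<equiv> det (cmat p d (monom 1 a * [:- [:0, 1:], 1:] ^ b * (\<Prod>i<n. [:- s i, 1:] ^ e)))"
  shows "poly P v = det (cmat p d (monom 1 a * [:- v, 1:] ^ b * (\<Prod>i<n. [:- poly (s i) v, 1:] ^ e)))"
proof -
  have h: "comm_ring_hom (\<lambda>q :: 'a poly. poly q v)" ..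
  interpret mp: map_poly_comm_ring_hom "\<lambda>q :: 'a poly. poly q v" ..
  show ?thesis
    unfolding P_def poly_hom.hom_det_cmat mp.hom_mult mp.hom_power map_poly_linear_prod[OF h]
      poly_hom.map_poly_linear_factor
    by (simp add: map_poly_monom)
qed

text \<open>\<open>P\<close> vanishes at 0 to order exactly a + b - (p - 1): up to sign,
  \<open>poly Q 0\<close> is the product of a binomial coefficient, the constant term of the other
  factors and the smaller determinant.\<close>

lemma poly_det_collision_large:
  fixes s :: "nat \<Rightarrow> 'a::idom poly" and p d a b n e :: nat
  defines "P \<equiv> det (cmat p d (monom 1 a * [:- [:0, 1:], 1:] ^ b * (\<Prod>i<n. [:- s i, 1:] ^ e)))"
  assumes p: "prime p" "\<And>m. of_nat m = (0 :: 'a) \<longleftrightarrow> p dvd m"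
    and ab: "a \<le> p - 1" "b \<le> p - 1" "p - 1 \<le> a + b" and d: "d > 0"
    and nz: "\<And>i. i < n \<Longrightarrow> poly (s i) 0 \<noteq> 0"
      "det (cmat p (d - 1) (monom 1 (a + b - (p - 1)) * (\<Prod>i<n. [:- poly (s i) 0, 1:] ^ e))) \<noteq> 0"
  obtains Q where "P = [:0, 1:] ^ (a + b - (p - 1)) * Q" "poly Q 0 \<noteq> 0"
proof -
  have h: "comm_ring_hom (\<lambda>q :: 'a poly. poly q 0)" ..
  have p0: "p > 0" using p(1) by (rule prime_gt_0_nat)
  let ?G = "\<Prod>i<n. [:- s i, 1:] ^ e"
  define Q where "Q = det (collision_mat p d (monom 1 a * lower_part (p - 1) a b [:0, 1:] * ?G)
    (monom 1 a * [:- [:0, 1:], 1:] ^ b * ?G))"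
  have "P = [:0, 1:] ^ (a + b - (p - 1)) * Q"
    unfolding P_def Q_def using ab d by (rule det_cmat_collision)
  moreover have "poly Q 0 = of_nat (b choose (p - 1 - a)) * (-1) ^ (a + b - (p - 1)) *
      coeff (\<Prod>i<n. [:- poly (s i) 0, 1:] ^ e) 0 * (-1) ^ (d - 1) *
      det (cmat p (d - 1) (monom 1 (a + b - (p - 1)) * (\<Prod>i<n. [:- poly (s i) 0, 1:] ^ e)))"
    unfolding Q_def by (subst poly_hom.hom_det_collision_mat) (use ab d p0 in \<open>simp_all add: map_poly_linear_prod[OF h]\<close>)
  \<comment> \<open>As b < p, the prime does not divide the factorial of \<open>b\<close>, of which
    the binomial coefficient is a divisor.\<close>
  moreover have "of_nat (b choose (p - 1 - a)) \<noteq> (0 :: 'a)"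
  proof -
    have "\<not> p dvd fact b"
      using p(1) ab(2) p0 by (simp add: prime_dvd_fact_iff)
    moreover have "b choose (p - 1 - a) dvd fact b"
      using binomial_fact_lemma[of "p - 1 - a" b] ab by (metis dvd_triv_right diff_le_mono2 le_diff_conv add.commute)
    ultimately show ?thesis
      unfolding p(2) using dvd_trans by blast
  qed
  moreover have "coeff (\<Prod>i<n. [:- poly (s i) 0, 1:] ^ e) 0 \<noteq> 0"
    using nz(1) by (simp add: poly_prod flip: poly_0_coeff_0)
  ultimately show ?thesis
    using nz(2) that by simp
qed

text \<open>The roots are moved into \<open>0\<close> one after the other. A collision with \<open>e\<^sub>0 + e \<le> p - 1\<close> adds the
  exponents and keeps \<open>d\<close>; otherwise the exponent becomes \<open>e\<^sub>0 + e - (p - 1)\<close> and \<open>d\<close> drops by one. Roots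
  other than \<open>0\<close> are kept nonzero because the constant term of the remaining factor enters the
  leading coefficient in the second case.\<close>

lemma exists_det_cmat_nonzero:
  assumes p: "prime p" "\<And>m. of_nat m = (0 :: 'a::idom) \<longleftrightarrow> p dvd m" and inf: "infinite (UNIV :: 'a set)"
    and e: "e \<le> p - 1" "e\<^sub>0 \<le> p - 1"
    and d: "d * (p - 1) \<le> e\<^sub>0 + n * e" "e\<^sub>0 + n * e \<le> Suc d * (p - 1)"
  shows "\<exists>a :: nat \<Rightarrow> 'a. (\<forall>i<n. a i \<noteq> 0) \<and>
    det (cmat p d (monom 1 e\<^sub>0 * (\<Prod>i<n. [:- a i, 1:] ^ e))) \<noteq> 0"
  using e d
proof (induction n arbitrary: e\<^sub>0 d)
  case 0
  have q: "p - 1 > 0" using prime_gt_1_nat[OF p(1)] by simp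
  have "d * (p - 1) \<le> p - 1" using 0 by linarith
  with q have "d \<le> 1" by (metis mult_le_cancel2 nat_mult_1)
  \<comment> \<open>With no roots left to move, the matrix is empty or has the single entry
    1.\<close>
  then consider "d = 0" | "d = 1" by linarith
  then show ?case
  proof cases
    case 2
    with 0 have "e\<^sub>0 = p - 1" by simp
    with 2 show ?thesis
      by (simp add: det_single cmat_index)
  qed simp
next
  case (Suc n)
  show ?case
  proof (cases "d = 0")
    case True
    then show ?thesis by (auto intro!: exI[of _ "\<lambda>_. 1"])
  next
    case False
    \<comment> \<open>The root of index \<open>n\<close> stays an indeterminate until the other
      roots have been chosen.\<close>
    define P where "P a = det (cmat p d (monom 1 e\<^sub>0 * [:- [:0, 1:], 1:] ^ e * (\<Prod>i<n. [:- [:a i:], 1:] ^ e)))"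
      for a :: "nat \<Rightarrow> 'a"
    have "\<exists>a. (\<forall>i<n. a i \<noteq> 0) \<and> P a \<noteq> 0"
    proof (cases "e\<^sub>0 + e \<le> p - 1")
      case True
      have "\<exists>a :: nat \<Rightarrow> 'a. (\<forall>i<n. a i \<noteq> 0) \<and>
          det (cmat p d (monom 1 (e\<^sub>0 + e) * (\<Prod>i<n. [:- a i, 1:] ^ e))) \<noteq> 0"
        using Suc.prems True by (intro Suc.IH) simp_all
      then obtain a :: "nat \<Rightarrow> 'a" where a: "\<forall>i<n. a i \<noteq> 0"
        "det (cmat p d (monom 1 (e\<^sub>0 + e) * (\<Prod>i<n. [:- a i, 1:] ^ e))) \<noteq> 0" by blast
      have "[:0, 1:] ^ e = monom (1 :: 'a) e" by (simp add: monom_altdef)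
      then have "poly (P a) 0 = det (cmat p d (monom 1 (e\<^sub>0 + e) * (\<Prod>i<n. [:- a i, 1:] ^ e)))"
        unfolding P_def poly_det_collision_small by (simp add: mult_monom)
      with a show ?thesis by (intro exI[of _ a]) auto
    next
      case large: False
      \<comment> \<open>Lowering the total exponent by p - 1 and \<open>d\<close> by one keeps both
        inequalities of the induction hypothesis.\<close>
      have "\<exists>a :: nat \<Rightarrow> 'a. (\<forall>i<n. a i \<noteq> 0) \<and>
          det (cmat p (d - 1) (monom 1 (e\<^sub>0 + e - (p - 1)) * (\<Prod>i<n. [:- a i, 1:] ^ e))) \<noteq> 0"
        using Suc.prems large False by (intro Suc.IH) (auto simp: algebra_simps diff_mult_distrib)
      then obtain a :: "nat \<Rightarrow> 'a" where a: "\<forall>i<n. a i \<noteq> 0"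
        "det (cmat p (d - 1) (monom 1 (e\<^sub>0 + e - (p - 1)) * (\<Prod>i<n. [:- a i, 1:] ^ e))) \<noteq> 0" by blast
      obtain Q where "P a = [:0, 1:] ^ (e\<^sub>0 + e - (p - 1)) * Q" "poly Q 0 \<noteq> 0"
        unfolding P_def
        by (rule poly_det_collision_large[OF p, of e\<^sub>0 e d n "\<lambda>i. [:a i:]" e])
           (use Suc.prems large False a in auto)
      then have "P a \<noteq> 0" by auto
      with a show ?thesis by blast
    qed
    then obtain a where a: "\<forall>i<n. a i \<noteq> 0" "P a \<noteq> 0" by blast
    \<comment> \<open>The extra factor x makes one choice of a nonroot serve both as a nonzero root
      and as a point where \<open>P a\<close> does not vanish.\<close>
    then have "[:0, 1:] * P a \<noteq> 0" by simp
    then have "finite {v. poly ([:0, 1:] * P a) v = 0}"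
      by (rule poly_roots_finite)
    with inf obtain v where "poly ([:0, 1:] * P a) v \<noteq> 0"
      by (metis (mono_tags, lifting) UNIV_eq_I mem_Collect_eq)
    then have v: "v \<noteq> 0" "poly (P a) v \<noteq> 0" by auto
    have "monom 1 e\<^sub>0 * (\<Prod>i<Suc n. [:- (a(n := v)) i, 1:] ^ e) =
        monom 1 e\<^sub>0 * [:- v, 1:] ^ e * (\<Prod>i<n. [:- a i, 1:] ^ e)"
      by (simp add: mult_ac)
    with v(2) have "det (cmat p d (monom 1 e\<^sub>0 * (\<Prod>i<Suc n. [:- (a(n := v)) i, 1:] ^ e))) \<noteq> 0"
      unfolding P_def poly_det_collision_small by (simp only: poly_pCons poly_0 mult_zero_right add_0_right not_False_eq_True)
    moreover have "\<forall>i<Suc n. (a(n := v)) i \<noteq> 0"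
      using v(1) a(1) by (simp add: less_Suc_eq)
    ultimately show ?thesis by blast
  qed
qed

section \<open>Vanishing rows and scaling of the roots\<close>

lemma det_zero_row:
  assumes "A \<in> carrier_mat n n" "i < n" "\<And>j. j < n \<Longrightarrow> A $$ (i, j) = 0"
  shows "det A = 0"
  using laplace_expansion_row[OF assms(1,2)] assms(3) by simp

lemma det_mat_diag: "det (mat_diag n f) = (\<Prod>i<n. f i)"
proof -
  have "det (mat_diag n f) = prod_list (diag_mat (mat_diag n f))"
    by (rule det_upper_triangular[of _ n]) (auto simp: mat_diag_def)
  then show ?thesis
    by (simp add: prod_list_diag_prod mat_diag_def atLeast0LessThan)
qed

text \<open>\<open>F'\<close> stands for \<open>F\<close> with its roots multiplied by
  \<open>t\<close>, and \<open>n\<close> for the degree. Entries read the exponent (i + 1) p - (d -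
  j), so diagonal matrices of powers of \<open>t\<close> intertwine the two matrices. Nothing is
  divided by \<open>t\<close>, which need not be invertible.\<close>

lemma det_cmat_scale:
  fixes t :: "'a::comm_ring_1"
  assumes "p > 0" and scale: "\<And>k. t ^ k * coeff F' k = t ^ n * coeff F k"
  shows "t ^ (p * (\<Sum>i<d. Suc i)) * det (cmat p d F') = t ^ (n * d + (\<Sum>i<d. Suc i)) * det (cmat p d F)"
proof -
  let ?U = "mat_diag d (\<lambda>i. t ^ (Suc i * p))" and ?V = "mat_diag d (\<lambda>j. t ^ (n + (d - j)))"
  have UV: "?U \<in> carrier_mat d d" "?V \<in> carrier_mat d d" by simp_all
  have "?U * cmat p d F' = cmat p d F * ?V"
    unfolding mat_diag_mult_left[OF cmat_carrier] mat_diag_mult_right[OF cmat_carrier]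
  proof (rule cong_mat[OF refl refl])
    fix i j assume ij: "i < d" "j < d"
    define k where "k = Suc i * p - 1"
    have k: "Suc i * p = Suc k" using assms(1) by (simp add: k_def)
    have "t ^ Suc k * coeff (monom 1 (d - 1 - j) * F') k = coeff (monom 1 (d - 1 - j) * F) k * t ^ (n + (d - j))"
    proof (cases "d - 1 - j \<le> k")
      case True
      then have *: "Suc k = (k - (d - 1 - j)) + (d - j)" using ij by simp
      have "t ^ Suc k * coeff F' (k - (d - 1 - j)) = t ^ (d - j) * (t ^ (k - (d - 1 - j)) * coeff F' (k - (d - 1 - j)))"
        by (subst *) (simp only: power_add mult_ac)
      also have "\<dots> = coeff F (k - (d - 1 - j)) * t ^ (n + (d - j))"
        unfolding scale by (simp only: power_add mult_ac)
      finally show ?thesis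
        using True by (simp add: coeff_monom_mult)
    qed (simp add: coeff_monom_mult)
    with ij show "(case (i, j) of (i, j) \<Rightarrow> t ^ (Suc i * p) * cmat p d F' $$ (i, j)) =
        (case (i, j) of (i, j) \<Rightarrow> cmat p d F $$ (i, j) * t ^ (n + (d - j)))"
      by (simp only: prod.case cmat_index k diff_Suc_1)
  qed
  then have "det ?U * det (cmat p d F') = det (cmat p d F) * det ?V"
    using det_mult[OF UV(1) cmat_carrier] det_mult[OF cmat_carrier UV(2)] by metis
  moreover have "det ?U = t ^ (p * (\<Sum>i<d. Suc i))"
    by (simp only: det_mat_diag mult.commute[of _ p] sum_distrib_left power_sum)
  moreover have "det ?V = t ^ (n * d + (\<Sum>i<d. Suc i))"
  proof -
    have "(\<Sum>j<d. d - j) = (\<Sum>i<d. Suc i)"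
      by (subst sum.nat_diff_reindex[symmetric]) (auto intro: sum.cong)
    then show ?thesis
      by (simp only: det_mat_diag power_sum[symmetric] sum.distrib sum_constant card_lessThan
          of_nat_id mult.commute[of d n])
  qed
  ultimately show ?thesis by (simp add: mult.commute)
qed

lemma coeff_scale_roots:
  fixes t :: "'a::comm_ring_1"
  shows "t ^ k * coeff ((\<Prod>i<r. [:- (t * s i), 1:]) ^ e) k = t ^ (r * e) * coeff ((\<Prod>i<r. [:- s i, 1:]) ^ e) k"
proof -
  have "[:- (t * c), 1:] \<circ>\<^sub>p [:0, t:] = smult t [:- c, 1:]" for c
    by (simp add: pcompose_pCons)
  then have "(\<Prod>i<r. [:- (t * s i), 1:]) \<circ>\<^sub>p [:0, t:] = smult (t ^ r) (\<Prod>i<r. [:- s i, 1:])"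
    by (simp only: pcompose_hom.hom_prod prod_smult prod_constant card_lessThan)
  then have "((\<Prod>i<r. [:- (t * s i), 1:]) ^ e) \<circ>\<^sub>p [:0, t:] = smult (t ^ (r * e)) ((\<Prod>i<r. [:- s i, 1:]) ^ e)"
    by (simp add: pcompose_hom.hom_power smult_power power_mult)
  from arg_cong[OF this, of "\<lambda>f. coeff f k"] show ?thesis
    by (simp add: coeff_pcompose_linear)
qed

section \<open>The determinant as a polynomial in the roots\<close>

definition root_prod :: "nat \<Rightarrow> (nat \<Rightarrow> 'a::comm_ring_1) \<Rightarrow> 'a poly" where
  "root_prod r s = (\<Prod>i<r. [:- s i, 1:])"

lemma fpoly_eq_root_prod: "fpoly r = root_prod r Var"
  by (simp add: fpoly_def root_prod_def)

lemma root_prod_power: "root_prod r s ^ e = (\<Prod>i<r. [:- s i, 1:] ^ e)"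
  by (simp add: root_prod_def prod_power_distrib)

lemma ev_det_cmat:
  assumes "comm_ring_hom c"
  shows "ev c s (det (cmat p d (fpoly r ^ e))) = det (cmat p d (root_prod r s ^ e))"
proof -
  have h: "comm_ring_hom (ev c s)"
    using assms by (rule comm_ring_hom_ev)
  show ?thesis
    unfolding comm_ring_hom.hom_det_cmat[OF h] fpoly_eq_root_prod root_prod_power map_poly_linear_prod[OF h]
    by (simp add: ev_Var[OF assms])
qed

lemma degree_root_prod_power: "degree (root_prod r s ^ e) \<le> r * e"
proof -
  have "degree (root_prod r s) \<le> sum (degree \<circ> (\<lambda>i. [:- s i, 1:])) {..<r}"
    unfolding root_prod_def by (rule degree_prod_sum_le) simp
  also have "\<dots> = r" by simp
  finally show ?thesis
    by (meson degree_power_le le_trans mult_le_mono1)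
qed

lemma Var_neq_0: "Var i \<noteq> (0 :: 'a::comm_ring_1 mpoly)"
  by (metis Var_def lookup_single_eq lookup_zero zero_neq_one)

text \<open>The last row reads only exponents from d (p - 1) upwards, beyond the degree.\<close>

lemma det_cmat_power_eq_0_low_degree:
  assumes "r * e < d * (p - 1)"
  shows "det (cmat p d (root_prod r s ^ e)) = 0"
proof (rule det_zero_row)
  show "d - 1 < d" using assms by (cases d) auto
  fix j assume j: "j < d"
  have "d * (p - 1) \<le> d * p - 1 - (d - 1 - j)"
    using j by (simp add: diff_mult_distrib2)
  then have "coeff (root_prod r s ^ e) (d * p - 1 - (d - 1 - j)) = 0"
    using degree_root_prod_power[of r s e] assms by (intro coeff_eq_0) linarith
  with j show "cmat p d (root_prod r s ^ e) $$ (d - 1, j) = 0"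
    by (simp add: cmat_index coeff_monom_mult)
qed simp

text \<open>A root 0 makes x ^ e a factor, while the first row reads only exponents below
  \<open>p\<close>.\<close>

lemma det_cmat_root_prod_power_eq_0_zero_root:
  assumes "s 0 = 0" "r > 0" "p \<le> e" "d > 0" "p > 0"
  shows "det (cmat p d (root_prod r s ^ e)) = 0"
proof (rule det_zero_row)
  fix j assume "j < d"
  have "root_prod r s = [:0, 1:] * (\<Prod>i\<in>{..<r} - {0}. [:- s i, 1:])"
    unfolding root_prod_def using assms(1,2) by (subst prod.remove[of _ 0]) auto
  then have "root_prod r s ^ e = monom 1 e * (\<Prod>i\<in>{..<r} - {0}. [:- s i, 1:]) ^ e"
    by (simp only: power_mult_distrib monom_altdef smult_1_left)
  then show "cmat p d (root_prod r s ^ e) $$ (0, j) = 0"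
    using \<open>j < d\<close> assms by (simp add: cmat_index coeff_monom_mult)
qed (use assms in simp_all)

lemma comm_ring_hom_coeff_const: "comm_ring_hom (\<lambda>x :: 'a::comm_ring_1. [:Const x:])"
  by (rule comm_ring_hom_compose[OF comm_ring_hom_Const comm_ring_hom_const_poly])

subsection \<open>Homogeneity\<close>

text \<open>Adjoins a grading variable t by sending x_i to t x_i: \<open>P\<close> is homogeneous of
  degree n exactly when its image is t ^ n P.\<close>

definition grade_hom :: "'a::comm_ring_1 mpoly \<Rightarrow> 'a mpoly poly" where
  "grade_hom = ev (\<lambda>x. [:Const x:]) (\<lambda>i. [:0, 1:] * [:Var i:])"

lemma comm_ring_hom_grade_hom: "comm_ring_hom grade_hom"
  unfolding grade_hom_def by (rule comm_ring_hom_ev[OF comm_ring_hom_coeff_const])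

text \<open>Homogeneity of degree d r e - (p - 1) d (d + 1) / 2, with powers of t on both sides to
  avoid subtraction.\<close>

lemma grade_hom_det:
  assumes "p > 0"
  shows "[:0, 1:] ^ (p * (\<Sum>i<d. Suc i)) * grade_hom (det (cmat p d (fpoly r ^ e))) =
    [:0, 1:] ^ (r * e * d + (\<Sum>i<d. Suc i)) * [:det (cmat p d (fpoly r ^ e)):]"
proof -
  have eq: "[:det (cmat p d (fpoly r ^ e)):] = det (cmat p d (root_prod r (\<lambda>i. [:Var i:]) ^ e))"
    unfolding comm_ring_hom.hom_det_cmat[OF comm_ring_hom_const_poly] fpoly_eq_root_prod root_prod_power
      map_poly_linear_prod[OF comm_ring_hom_const_poly] ..
  show ?thesis
    unfolding grade_hom_def ev_det_cmat[OF comm_ring_hom_coeff_const] eq root_prod_def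
    by (rule det_cmat_scale[OF assms coeff_scale_roots])
qed

lemma grade_hom_delta: "grade_hom (delta r) = [:0, 1:] ^ card (pairs r) * [:delta r:]"
proof -
  interpret comm_ring_hom "\<lambda>x :: 'a mpoly. [:x:]"
    by (rule comm_ring_hom_const_poly)
  have "grade_hom (delta r) = (\<Prod>(i, j)\<in>pairs r. [:0, 1:] * [:Var i - Var j :: 'a mpoly:])"
    unfolding grade_hom_def ev_delta[OF comm_ring_hom_coeff_const]
    by (rule prod.cong) (auto simp: algebra_simps)
  also have "\<dots> = [:0, 1:] ^ card (pairs r) * (\<Prod>(i, j)\<in>pairs r. [:Var i - Var j:])"
    by (simp only: case_prod_unfold prod.distrib prod_constant)
  also have "(\<Prod>(i, j)\<in>pairs r. [:Var i - Var j :: 'a mpoly:]) = [:delta r:]"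
    by (simp only: delta_eq_prod_pairs hom_prod case_prod_unfold)
  finally show ?thesis .
qed

text \<open>Setting t = 0 sends all indeterminates to 0 and leaves the constant coefficient, yet by
  hypothesis it returns \<open>Q\<close>.\<close>

lemma grade_hom_fixed_imp_Const:
  assumes "grade_hom Q = [:Q:]"
  shows "Q = Const (Poly_Mapping.lookup Q 0)"
proof -
  have monom_ev_zero: "monom_ev (\<lambda>_. 0 :: 'a mpoly) m = (if m = 0 then 1 else 0)" for m
  proof (cases "m = 0")
    case False
    then obtain i where "i \<in> Poly_Mapping.keys m"
      by (metis ex_in_conv keys_eq_empty)
    then show ?thesis
      using False by (auto simp: monom_ev_def in_keys_iff power_0_left intro!: prod_zero bexI[of _ i])
  qed simp
  have "Q = poly (grade_hom Q) 0"
    using assms by simp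
  also have "\<dots> = (\<Sum>m\<in>Poly_Mapping.keys Q. Const (Poly_Mapping.lookup Q m) * monom_ev (\<lambda>_. 0) m)"
    by (simp add: grade_hom_def ev_def poly_sum monom_ev_def poly_prod)
  also have "\<dots> = Const (Poly_Mapping.lookup Q 0)"
    by (auto simp: monom_ev_zero if_distrib sum.delta in_keys_iff Const_def cong: if_cong)
  finally show ?thesis .
qed

lemma shift_const_poly_eqD:
  assumes "[:0, 1:] ^ m * [:c:] = [:0, 1:] ^ n * [:c:]" "c \<noteq> (0 :: 'a::idom)"
  shows "m = n"
proof -
  have "[:0, 1:] ^ k * [:c:] = monom c k" for k
    by (simp add: monom_altdef)
  with assms show ?thesis
    by (metis degree_monom_eq)
qed

subsection \<open>Degree in one root\<close>

lemma degree_coeff_mult_le: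
  fixes F G :: "'a::comm_ring_1 poly poly"
  assumes "\<And>k. degree (coeff F k) \<le> a" "\<And>k. degree (coeff G k) \<le> b"
  shows "degree (coeff (F * G) k) \<le> a + b"
  unfolding coeff_mult
  by (rule degree_sum_le) (auto intro: order_trans[OF degree_mult_le] add_mono assms)

text \<open>The product of the linear factors has degree at most one in the root of index 0, so
  every entry has degree at most \<open>e\<close> in it.\<close>

lemma degree_det_cmat_le:
  fixes s :: "nat \<Rightarrow> 'a::comm_ring_1 poly"
  assumes "\<And>i. degree (s i) \<le> (if i = 0 then 1 else 0)"
  shows "degree (det (cmat p d (root_prod r s ^ e))) \<le> e * d"
proof (rule degree_det_le)
  have linear: "degree (coeff [:- s i, 1:] k) \<le> (if i = 0 then 1 else 0)" for i k
    using assms[of i] by (auto simp: coeff_pCons split: nat.splits)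
  have "degree (coeff (\<Prod>i<r. [:- s i, 1:]) k) \<le> (\<Sum>i<r. if i = 0 then 1 else 0)" for k
  proof (induction r arbitrary: k)
    case (Suc r)
    show ?case
      unfolding prod.lessThan_Suc sum.lessThan_Suc
      by (rule degree_coeff_mult_le) (use Suc linear in auto)
  qed (simp add: coeff_1)
  moreover have "(\<Sum>i<r. if i = 0 then 1 else 0) \<le> (1 :: nat)"
    by (simp add: sum.delta)
  ultimately have root_prod: "degree (coeff (root_prod r s) k) \<le> 1" for k
    unfolding root_prod_def by (rule order_trans)
  have "degree (coeff (root_prod r s ^ e) k) \<le> e" for k
  proof (induction e arbitrary: k)
    case (Suc e)
    show ?case
      unfolding power_Suc using degree_coeff_mult_le[of "root_prod r s" 1 "root_prod r s ^ e" e] Suc root_prod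
      by simp
  qed (simp add: coeff_1)
  then show "degree (cmat p d (root_prod r s ^ e) $$ (i, j)) \<le> e" if "i < d" "j < d" for i j
    using that by (simp add: cmat_index coeff_monom_mult)
qed simp

text \<open>With x_0 as the polynomial variable, exactly the r - 1 factors with i = 0 have degree
  one; degrees add up over a domain.\<close>

lemma degree_first_root_delta:
  fixes \<epsilon> :: "'a::idom"
  assumes "\<epsilon> \<noteq> 0"
  shows "degree (ev (\<lambda>x. [:Const x:]) (\<lambda>i. if i = 0 then [:0, 1:] else [:Var i:]) (Const \<epsilon> * delta r ^ g)) = g * (r - 1)"
proof -
  let ?c = "\<lambda>x :: 'a. [:Const x:]" and ?s = "\<lambda>i. if i = 0 then [:0, 1:] else [:Var i :: 'a mpoly:]"
  interpret h: comm_ring_hom "ev ?c ?s"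
    by (rule comm_ring_hom_ev[OF comm_ring_hom_coeff_const])
  have factor: "?s i - ?s j \<noteq> 0" "degree (?s i - ?s j) = (if i = 0 then 1 else 0)" if "i < j" for i j
    using that Var_diff_neq_0[of i j, where 'a = 'a] by auto
  have nonzero: "(case x of (i, j) \<Rightarrow> ?s i - ?s j) \<noteq> 0" if "x \<in> pairs r" for x
    unfolding case_prod_unfold by (rule factor(1)) (use that in \<open>auto simp: pairs_def\<close>)
  have \<delta>: "ev ?c ?s (delta r) = (\<Prod>(i, j)\<in>pairs r. ?s i - ?s j)"
    by (rule ev_delta[OF comm_ring_hom_coeff_const])
  have "degree (ev ?c ?s (delta r)) = (\<Sum>(i, j)\<in>pairs r. degree (?s i - ?s j))"
  proof -
    have "\<forall>x\<in>pairs r. (case x of (i, j) \<Rightarrow> ?s i - ?s j) \<noteq> 0"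
      using nonzero by blast
    from degree_prod_eq_sum_degree[OF this] show ?thesis
      unfolding \<delta> by (simp only: case_prod_unfold)
  qed
  also have "\<dots> = (\<Sum>(i, j)\<in>pairs r. if i = 0 then 1 else 0)"
    by (rule sum.cong) (auto simp: pairs_def factor(2))
  also have "\<dots> = (\<Sum>i<r. \<Sum>j\<in>{i<..<r}. if i = 0 then 1 else 0)"
    unfolding pairs_def by (rule sum.Sigma[symmetric]) auto
  also have "\<dots> = (\<Sum>i<r. if i = 0 then r - 1 else 0)"
    by (rule sum.cong) auto
  also have "\<dots> = r - 1"
    by (cases r) (simp_all add: sum.delta)
  finally have degree: "degree (ev ?c ?s (delta r)) = r - 1" .
  have "ev ?c ?s (delta r) \<noteq> 0"
    unfolding \<delta> prod_zero_iff[OF finite_pairs] using nonzero by blast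
  moreover have "Const \<epsilon> \<noteq> 0"
    using assms by (metis Const_def lookup_single_eq lookup_zero)
  ultimately show ?thesis
    by (simp add: h.hom_mult h.hom_power ev_Const[OF comm_ring_hom_coeff_const] degree_power_eq degree)
qed

subsection \<open>Order of vanishing along the diagonals\<close>

text \<open>Translation by x_j moves the two roots to x_i - x_j and 0, and then the power is a
  common factor of the first row.\<close>

lemma Var_diff_power_dvd_det:
  fixes i j :: nat
  assumes p: "prime p" "of_nat p = (0 :: 'a::comm_ring_1)" and ij: "i < j" "j < r"
    and e: "e \<le> p - 1" "p - 1 \<le> 2 * e" and d: "d > 0" "r * e \<le> Suc d * (p - 1)"
  shows "(Var i - Var j) ^ (2 * e - (p - 1)) dvd det (cmat p d (fpoly r ^ e :: 'a mpoly poly))"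
proof -
  define H :: "'a mpoly poly" where "H = (\<Prod>k\<in>{..<r} - {i} - {j}. [:- Var k, 1:])"
  have "fpoly r = [:- Var i, 1:] * ([:- Var j, 1:] * H)"
    unfolding fpoly_def H_def using ij
    by (subst prod.remove[of _ i], simp, simp, subst prod.remove[of _ j]) auto
  moreover have "[:- c, 1:] \<circ>\<^sub>p [:Var j, 1:] = [:- (c - Var j), 1:]" for c :: "'a mpoly"
    by (simp add: pcompose_pCons)
  ultimately have "(fpoly r ^ e) \<circ>\<^sub>p [:Var j, 1:] =
      ([:- (Var i - Var j), 1:] * ([:- (Var j - Var j), 1:] * (H \<circ>\<^sub>p [:Var j, 1:]))) ^ e"
    by (simp only: pcompose_mult pcompose_hom.hom_power)
  also have "[:- (Var j - Var j), 1:] = [:0, 1 :: 'a mpoly:]"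
    by simp
  finally have "(fpoly r ^ e) \<circ>\<^sub>p [:Var j, 1:] =
      monom 1 e * [:- (Var i - Var j), 1:] ^ e * (H \<circ>\<^sub>p [:Var j, 1:]) ^ e"
    by (simp only: power_mult_distrib monom_altdef smult_1_left mult_ac)
  moreover have "of_nat p = (0 :: 'a mpoly)"
    using p(2) by (metis single_of_nat single_zero)
  moreover have "degree (fpoly r ^ e :: 'a mpoly poly) \<le> Suc d * (p - 1)"
    using degree_root_prod_power d(2) unfolding fpoly_eq_root_prod by (rule order_trans)
  ultimately have "det (cmat p d (fpoly r ^ e)) =
      det (cmat p d (monom 1 e * [:- (Var i - Var j), 1:] ^ e * (H \<circ>\<^sub>p [:Var j, 1:]) ^ e))"
    using det_cmat_translate[OF p(1), of "fpoly r ^ e :: 'a mpoly poly" d "Var j"] by simp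
  moreover have "p - 1 \<le> e + e"
    using e(2) by simp
  note det_cmat_collision[OF e(1) e(1) this d(1)]
  ultimately show ?thesis
    unfolding mult_2 by (metis dvd_triv_left)
qed

text \<open>The roots are specialised over the polynomial ring of the finite field, an infinite
  domain of characteristic \<open>p\<close>, as \<open>exists_det_cmat_nonzero\<close> demands. For
  the order, one root is put at 0 and another becomes a new indeterminate T; then T ^ g divides the
  specialised determinant.\<close>

lemma
  fixes r e d :: nat
  defines "p \<equiv> CARD('p::prime_card)"
  assumes d: "d * (p - 1) \<le> r * e" "r * e \<le> Suc d * (p - 1)" and e: "e \<le> p - 1"
  shows det_cmat_fpoly_nonzero: "det (cmat p d (fpoly r ^ e :: 'p mod_ring mpoly poly)) \<noteq> 0"
    and det_cmat_fpoly_order: "\<And>\<epsilon> :: 'p mod_ring. \<And>g. r \<ge> 2 \<Longrightarrow> d > 0 \<Longrightarrow> g > 0 \<Longrightarrow>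
      det (cmat p d (fpoly r ^ e :: 'p mod_ring mpoly poly)) = Const \<epsilon> * delta r ^ g \<Longrightarrow>
      p - 1 < 2 * e \<and> g \<le> 2 * e - (p - 1)"
proof -
  have p: "prime p"
    unfolding p_def by (rule prime_card)
  have char: "of_nat m = (0 :: 'p mod_ring poly) \<longleftrightarrow> p dvd m" for m
    by (simp add: of_nat_eq_0_iff_char_dvd p_def)
  have inf: "infinite (UNIV :: 'p mod_ring poly set)"
  proof
    assume "finite (UNIV :: 'p mod_ring poly set)"
    then have "finite (range (\<lambda>n. monom (1 :: 'p mod_ring) n))"
      by (rule finite_subset[rotated]) simp
    moreover have "inj (\<lambda>n. monom (1 :: 'p mod_ring) n)"
      by (rule injI) (metis degree_monom_eq zero_neq_one)
    ultimately show False
      using finite_imageD infinite_UNIV_nat by blast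
  qed
  note exists = exists_det_cmat_nonzero[OF p char inf e]
  have q: "p - 1 > 0" using prime_gt_1_nat[OF p] by simp
  show "det (cmat p d (fpoly r ^ e :: 'p mod_ring mpoly poly)) \<noteq> 0"
  proof
    assume 0: "det (cmat p d (fpoly r ^ e :: 'p mod_ring mpoly poly)) = 0"
    obtain a :: "nat \<Rightarrow> 'p mod_ring poly" where "det (cmat p d (monom 1 0 * (\<Prod>i<r. [:- a i, 1:] ^ e))) \<noteq> 0"
      using exists[of 0 d r] d by auto
    then have "ev (\<lambda>x. [:x:]) a (det (cmat p d (fpoly r ^ e))) \<noteq> 0"
      unfolding ev_det_cmat[OF comm_ring_hom_const_poly] root_prod_power by simp
    then show False
      unfolding 0 by (simp add: ev_def)
  qed
  fix \<epsilon> :: "'p mod_ring" and g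
  assume r: "r \<ge> 2" and d0: "d > 0" and g: "g > 0"
    and D: "det (cmat p d (fpoly r ^ e :: 'p mod_ring mpoly poly)) = Const \<epsilon> * delta r ^ g"
  define n where "n = r - 2"
  have rn: "r = Suc (Suc n)" using r by (simp add: n_def)
  \<comment> \<open>The roots of index \<open>n\<close> and n + 1 form the colliding pair; the
    others do not depend on T.\<close>
  define s where "s a = (\<lambda>i. if i < n then [:a i:] else if i = n then 0 else [:0, 1 :: 'p mod_ring poly:])" for a
  define P where "P a = det (cmat p d (monom 1 e * [:- [:0, 1:], 1:] ^ e * (\<Prod>i<n. [:- [:a i:], 1:] ^ e)))"
    for a :: "nat \<Rightarrow> 'p mod_ring poly"
  have c: "comm_ring_hom (\<lambda>x :: 'p mod_ring. [:[:x:]:])"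
    by (rule comm_ring_hom_compose[OF comm_ring_hom_const_poly comm_ring_hom_const_poly])
  have dvd: "[:0, 1:] ^ g dvd P a" for a
  proof -
    interpret h: comm_ring_hom "ev (\<lambda>x. [:[:x:]:]) (s a)"
      by (rule comm_ring_hom_ev[OF c])
    have "root_prod r (s a) ^ e = monom 1 e * [:- [:0, 1:], 1:] ^ e * (\<Prod>i<n. [:- [:a i:], 1:] ^ e)"
      unfolding root_prod_power rn by (simp add: s_def monom_altdef mult_ac)
    then have "P a = ev (\<lambda>x. [:[:x:]:]) (s a) (det (cmat p d (fpoly r ^ e)))"
      unfolding ev_det_cmat[OF c] P_def by simp
    moreover have "[:0, 1:] dvd ev (\<lambda>x. [:[:x:]:]) (s a) (delta r)"
    proof -
      have "s a n - s a (Suc n) dvd (\<Prod>(i, j)\<in>pairs r. s a i - s a j)"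
        using dvd_prodI[of "pairs r" "(n, Suc n)" "\<lambda>(i, j). s a i - s a j"] by (auto simp: pairs_def rn)
      moreover have "s a n - s a (Suc n) = - [:0, 1:]"
        by (simp add: s_def)
      ultimately show ?thesis
        unfolding ev_delta[OF c] by (metis minus_dvd_iff)
    qed
    ultimately show ?thesis
      unfolding D by (simp add: h.hom_mult h.hom_power dvd_power_same)
  qed
  show "p - 1 < 2 * e \<and> g \<le> 2 * e - (p - 1)"
  proof (cases "2 * e < p - 1")
    \<comment> \<open>Here the collision merely adds the multiplicities, and for suitable other
      roots \<open>P a\<close> is nonzero at 0, although T divides it.\<close>
    case True
    obtain a :: "nat \<Rightarrow> 'p mod_ring poly" where a: "det (cmat p d (monom 1 (e + e) * (\<Prod>i<n. [:- a i, 1:] ^ e))) \<noteq> 0"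
      using exists[of "e + e" d n] d True unfolding rn by auto
    have "[:0, 1:] ^ e = monom (1 :: 'p mod_ring poly) e" by (simp add: monom_altdef)
    then have "poly (P a) 0 = det (cmat p d (monom 1 (e + e) * (\<Prod>i<n. [:- a i, 1:] ^ e)))"
      unfolding P_def poly_det_collision_small by (simp add: mult_monom)
    moreover have "[:0, 1:] dvd P a"
      using dvd[of a] g by (metis dvd_power dvd_trans)
    ultimately show ?thesis
      using a by (auto elim!: dvdE)
  next
    case False
    have "\<exists>a :: nat \<Rightarrow> 'p mod_ring poly. (\<forall>i<n. a i \<noteq> 0) \<and>
        det (cmat p (d - 1) (monom 1 (e + e - (p - 1)) * (\<Prod>i<n. [:- a i, 1:] ^ e))) \<noteq> 0"
    proof (rule exists)
      have "e + e - (p - 1) + n * e = r * e - (p - 1)"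
        using False by (simp add: rn)
      moreover have "(d - 1) * q \<le> r * e - q" "r * e - q \<le> Suc (d - 1) * q"
        if "d * q \<le> r * e" "r * e \<le> Suc d * q" for q
        using that d0 by (cases d; simp)+
      ultimately show "(d - 1) * (p - 1) \<le> e + e - (p - 1) + n * e"
        "e + e - (p - 1) + n * e \<le> Suc (d - 1) * (p - 1)"
        using d by simp_all
    qed (use e in simp)
    then obtain a :: "nat \<Rightarrow> 'p mod_ring poly" where a: "\<forall>i<n. a i \<noteq> 0"
      "det (cmat p (d - 1) (monom 1 (e + e - (p - 1)) * (\<Prod>i<n. [:- a i, 1:] ^ e))) \<noteq> 0" by blast
    obtain Q where Q: "P a = [:0, 1:] ^ (e + e - (p - 1)) * Q" "poly Q 0 \<noteq> 0"
      unfolding P_def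
      by (rule poly_det_collision_large[OF p char, of e e d n "\<lambda>i. [:a i:]" e])
         (use d0 False e a in auto)
    have "g \<le> 2 * e - (p - 1)"
    proof (rule ccontr)
      assume "\<not> ?thesis"
      then have "[:0, 1 :: 'p mod_ring poly:] ^ Suc (e + e - (p - 1)) dvd [:0, 1:] ^ g"
        by (intro le_imp_power_dvd) simp
      then have "[:0, 1:] ^ Suc (e + e - (p - 1)) dvd P a"
        using dvd[of a] by (rule dvd_trans)
      then have "[:0, 1:] ^ (e + e - (p - 1)) * [:0, 1:] dvd [:0, 1:] ^ (e + e - (p - 1)) * Q"
        unfolding Q(1) power_Suc2 .
      then have "[:0, 1:] dvd Q"
        unfolding dvd_mult_cancel_left by simp
      with Q(2) show False by (auto elim!: dvdE)
    qed
    \<comment> \<open>As g > 0, the bound on \<open>g\<close> also rules out 2 e = p - 1.\<close>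
    with g show ?thesis by simp
  qed
qed

section \<open>The classification\<close>

lemma two_sum_Suc: "2 * (\<Sum>i<d. Suc i) = d * (d + 1)"
  by (induction d) simp_all

text \<open>The last equation says that the determinant and \<delta> ^ (2 e - (p - 1)) have equal
  degree. It is checked over the integers, where the differences are not truncated.\<close>

lemma B_set_bounds:
  assumes "(r, e, d) \<in> B_set p" "p \<ge> 2"
  shows "2 \<le> r" "1 \<le> e" "1 \<le> d" "d \<le> p" "e \<le> p - 1" "p - 1 < 2 * e"
    "d * (p - 1) \<le> r * e" "r * e \<le> Suc d * (p - 1)"
    "2 * (r * e * d) = (p - 1) * (d * (d + 1)) + r * (r - 1) * (2 * e - (p - 1))"
proof -
  define q where "q = p - 1"
  have q: "q \<ge> 1" "int p = int q + 1" "p = Suc q" using assms(2) by (auto simp: q_def)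
  have "2 \<le> r \<and> 1 \<le> e \<and> 1 \<le> d \<and> d \<le> p \<and> e \<le> q \<and> q < 2 * e \<and>
    int d * int q \<le> int r * int e \<and> int r * int e \<le> (int d + 1) * int q \<and>
    2 * (int r * int e * int d) = int q * (int d * (int d + 1)) + int r * (int r - 1) * (2 * int e - int q)"
    using assms(1) unfolding B_set_def
  proof (elim UnE)
    assume "(r, e, d) \<in> B_plus p"
    then have "2 \<le> r" "r \<le> p" "int e = int q" "d = r" by (auto simp: B_plus_def q)
    then show ?thesis using q(1) by (auto simp: algebra_simps)
  next
    assume "(r, e, d) \<in> B_zero p"
    then have *: "2 \<le> r" "r \<le> p + 1" "int q < 2 * int e" "int e \<le> int q"
      "int r * (int q - int e) \<le> int q" "int d = int r - 1" by (auto simp: B_zero_def q)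
    then have "int r * int e \<le> int r * int q" by (intro mult_left_mono) auto
    moreover have "1 \<le> d" "d \<le> p" using *(1,2,6) by linarith+
    ultimately show ?thesis using * unfolding *(6) by (auto simp: algebra_simps)
  next
    assume "(r, e, d) \<in> B_minus p"
    then have *: "2 \<le> r" "int q < 2 * int e" "int e \<le> int q"
      "int r * (int q - int e) = int q" "int d = int r - 2" by (auto simp: B_minus_def q)
    \<comment> \<open>r = 2 would give 2 e = q; its exclusion makes d = r - 2 positive.\<close>
    have "r \<noteq> 2" using *(2,4) by auto
    have "int q - int e \<ge> 1" using *(3,4) q(1) by (cases "int q = int e") auto
    then have "int r * 1 \<le> int r * (int q - int e)" by (intro mult_left_mono) auto
    then have "int r \<le> int q" using *(4) by simp
    have re: "int r * int e = (int r - 1) * int q" using *(4) by (simp add: algebra_simps)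
    have "int r * (int r - 1) * (2 * int e - int q) = (int r - 1) * (2 * (int r * int e) - int r * int q)"
      by (simp add: algebra_simps)
    moreover have "1 \<le> d" "d \<le> p" using *(1,5) \<open>r \<noteq> 2\<close> \<open>int r \<le> int q\<close> q(3) by linarith+
    ultimately show ?thesis
      using * unfolding *(5) re by (auto simp: algebra_simps)
  qed
  then have nat: "2 \<le> r" "1 \<le> e" "1 \<le> d" "d \<le> p" "e \<le> q" "q < 2 * e"
    and int: "int d * int q \<le> int r * int e" "int r * int e \<le> (int d + 1) * int q"
      "2 * (int r * int e * int d) = int q * (int d * (int d + 1)) + int r * (int r - 1) * (2 * int e - int q)"
    by blast+
  have diff: "int (r - 1) = int r - 1" "int (2 * e - q) = 2 * int e - int q"
    using nat by simp_all
  have "int (d * q) \<le> int (r * e)" "int (r * e) \<le> int (Suc d * q)"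
    using int(1,2) by (simp_all add: algebra_simps)
  moreover have "int (2 * (r * e * d)) = int (q * (d * (d + 1)) + r * (r - 1) * (2 * e - q))"
    using int(3) by (simp only: of_nat_mult of_nat_add of_nat_numeral of_nat_1 diff)
  ultimately show "2 \<le> r" "1 \<le> e" "1 \<le> d" "d \<le> p" "e \<le> p - 1" "p - 1 < 2 * e"
    "d * (p - 1) \<le> r * e" "r * e \<le> Suc d * (p - 1)"
    "2 * (r * e * d) = (p - 1) * (d * (d + 1)) + r * (r - 1) * (2 * e - (p - 1))"
    unfolding q_def[symmetric] using nat by (simp_all only: of_nat_le_iff of_nat_eq_iff)
qed

text \<open>The inequalities force d \<le> r. If d = r then e = p - 1, and if d = r - 1 the lower
  bound on r e is the condition of \<open>B_zero\<close>; for smaller \<open>d\<close> the degree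
  equation leaves only d = r - 2.\<close>

lemma in_B_setI:
  assumes "2 \<le> r" "1 \<le> d" "d \<le> p" "p \<ge> 2" "e \<le> p - 1" "p - 1 < 2 * e" "g \<le> 2 * e - (p - 1)"
    and d: "d * (p - 1) \<le> r * e" "r * e \<le> Suc d * (p - 1)"
    and eq: "2 * (r * e * d) = (p - 1) * (d * (d + 1)) + r * (r - 1) * g"
  shows "(r, e, d) \<in> B_set p"
proof -
  define q where "q = p - 1"
  have q: "q \<ge> 1" "int p = int q + 1" "p = Suc q" using assms(4) by (auto simp: q_def)
  have e: "int e \<le> int q" "int q < 2 * int e" using assms(5,6) by (auto simp: q_def)
  have d1: "int d * int q \<le> int r * int e"
    using d(1) unfolding q_def[symmetric] by (metis of_nat_le_iff of_nat_mult)
  have "int (r * e) \<le> int (Suc d * q)"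
    using d(2) unfolding q_def[symmetric] by (simp only: of_nat_le_iff)
  then have d2: "int r * int e \<le> (int d + 1) * int q"
    by (simp add: algebra_simps)
  have "int d * int q \<le> int r * int q"
    using d1 mult_left_mono[OF e(1), of "int r"] by simp
  then have dr: "int d \<le> int r" using q(1) by simp
  consider "int d = int r" | "int d = int r - 1" | "int d < int r - 1" using dr by linarith
  then show ?thesis
  proof cases
    case 1
    then have "int r * int q \<le> int r * int e" using d1 by simp
    then have "int q \<le> int e" using assms(1) by simp
    then show ?thesis
      using 1 e assms(1,3) q unfolding B_set_def B_plus_def by auto
  next
    case 2
    then have "(int r - 1) * int q \<le> int r * int e" using d1 by simp
    then have "int r * (int q - int e) \<le> int q" by (simp add: algebra_simps)
    then show ?thesis
      using 2 e assms(1,3) q unfolding B_set_def B_zero_def by auto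
  next
    case 3
    have "int g \<le> 2 * int e - int q" using assms(6,7) by (simp add: q_def)
    moreover have "int (2 * (r * e * d)) = int (q * (d * (d + 1)) + r * (r - 1) * g)"
      using eq unfolding q_def[symmetric] by (simp only:)
    then have "2 * (int r * int e * int d) = int q * (int d * (int d + 1)) + int r * (int r - 1) * int g"
      using assms(1) by (simp only: of_nat_mult of_nat_add of_nat_numeral of_nat_1
          of_nat_diff[of 1 r, OF order_trans[OF one_le_numeral assms(1)]])
    moreover have "int r * (int r - 1) \<ge> 0" using assms(1) by simp
    ultimately have "2 * (int r * int e * int d) \<le>
        int q * (int d * (int d + 1)) + int r * (int r - 1) * (2 * int e - int q)"
      by (simp add: mult_left_mono)
    \<comment> \<open>As r (r - 1) - d (d + 1) = (r - 1 - d) (r + d), the factor r - 1 - d splits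
      off, and it is positive in this case.\<close>
    then have "(int r - 1 - int d) * (int q * (int r + int d)) \<le> (int r - 1 - int d) * (2 * (int r * int e))"
      by (simp add: algebra_simps)
    then have lower: "int q * (int r + int d) \<le> 2 * (int r * int e)"
      using 3 by simp
    then have "int q * (int r + int d) \<le> int q * (2 * (int d + 1))"
      using d2 by (simp add: algebra_simps)
    then have "int r + int d \<le> 2 * (int d + 1)" using q(1) by simp
    with 3 have d_eq: "int d = int r - 2" by presburger
    \<comment> \<open>Now the lower and the upper bound on r e are both (r - 1) q.\<close>
    then have "int r * (int q - int e) = int q"
      using lower d2 unfolding d_eq by (simp add: algebra_simps)
    then show ?thesis
      using d_eq e assms(1) q unfolding B_set_def B_minus_def by auto
  qed
qed

section \<open>The two inclusions\<close>

lemma det_eq_delta_power_imp_B_set: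
  fixes \<epsilon> :: "'p::prime_card mod_ring"
  assumes r: "r \<ge> 2" and d: "1 \<le> d" "d \<le> CARD('p)" and \<epsilon>: "\<epsilon> \<noteq> 0" and g: "g > 0"
    and D: "det (cmat CARD('p) d (fpoly r ^ e :: 'p mod_ring mpoly poly)) = Const \<epsilon> * delta r ^ g"
  shows "(r, e, d) \<in> B_set CARD('p)"
proof -
  let ?p = "CARD('p)"
  let ?D = "det (cmat ?p d (fpoly r ^ e :: 'p mod_ring mpoly poly))"
  have p: "prime ?p" by (rule prime_card)
  have p2: "?p \<ge> 2" using p by (rule prime_ge_2_nat)
  have Const_\<epsilon>: "Const \<epsilon> \<noteq> 0"
    using \<epsilon> by (metis Const_def lookup_single_eq lookup_zero)
  have D0: "?D \<noteq> 0"
    unfolding D using Const_\<epsilon> delta_neq_0[of r, where 'a = "'p mod_ring"] by simp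
  \<comment> \<open>If e \<ge> p, the determinant vanishes at x_0 = 0, where all differences of
    roots stay nonzero.\<close>
  have e: "e \<le> ?p - 1"
  proof (rule ccontr)
    assume "\<not> e \<le> ?p - 1"
    then have "?p \<le> e" by simp
    let ?s = "\<lambda>i. if i = 0 then 0 else Var i :: 'p mod_ring mpoly"
    interpret h: comm_ring_hom "ev Const ?s"
      by (rule comm_ring_hom_ev[OF comm_ring_hom_Const])
    have "ev Const ?s ?D = 0"
      unfolding ev_det_cmat[OF comm_ring_hom_Const]
      by (rule det_cmat_root_prod_power_eq_0_zero_root) (use \<open>?p \<le> e\<close> r d p2 in simp_all)
    then have "ev Const ?s (delta r) = 0"
      unfolding D h.hom_mult h.hom_power ev_Const[OF comm_ring_hom_Const] using Const_\<epsilon> by simp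
    then obtain i j where "(i, j) \<in> pairs r" "?s i - ?s j = 0"
      unfolding ev_delta[OF comm_ring_hom_Const] by auto
    then show False
      using Var_neq_0[of j, where 'a = "'p mod_ring"] Var_diff_neq_0[of i j, where 'a = "'p mod_ring"]
      by (auto simp: pairs_def split: if_splits)
  qed
  have lower: "d * (?p - 1) \<le> r * e"
    using D0 det_cmat_power_eq_0_low_degree[of r e d ?p Var] unfolding fpoly_eq_root_prod by fastforce
  have eq: "2 * (r * e * d) = (?p - 1) * (d * (d + 1)) + r * (r - 1) * g"
  proof -
    interpret h: comm_ring_hom "grade_hom :: 'p mod_ring mpoly \<Rightarrow> _"
      by (rule comm_ring_hom_grade_hom)
    interpret c: comm_ring_hom "\<lambda>x :: 'p mod_ring mpoly. [:x:]"
      by (rule comm_ring_hom_const_poly)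
    have "grade_hom ?D = [:Const \<epsilon>:] * ([:0, 1:] ^ card (pairs r) * [:delta r:]) ^ g"
      unfolding D h.hom_mult h.hom_power grade_hom_delta
      by (simp add: grade_hom_def ev_Const[OF comm_ring_hom_coeff_const])
    also have "\<dots> = [:0, 1:] ^ (card (pairs r) * g) * ([:Const \<epsilon>:] * [:delta r:] ^ g)"
      by (simp only: power_mult_distrib power_mult mult.left_commute)
    also have "[:Const \<epsilon>:] * [:delta r:] ^ g = [:?D:]"
      unfolding D c.hom_mult c.hom_power ..
    finally have "[:0, 1:] ^ (?p * (\<Sum>i<d. Suc i) + card (pairs r) * g) * [:?D:] =
        [:0, 1:] ^ (r * e * d + (\<Sum>i<d. Suc i)) * [:?D:]"
      using grade_hom_det[of ?p d r e, where 'a = "'p mod_ring"] p2 by (simp only: power_add mult.assoc)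
    then have "?p * (\<Sum>i<d. Suc i) + card (pairs r) * g = r * e * d + (\<Sum>i<d. Suc i)"
      using D0 by (rule shift_const_poly_eqD)
    then have "?p * (2 * (\<Sum>i<d. Suc i)) + (2 * card (pairs r)) * g = 2 * (r * e * d) + 2 * (\<Sum>i<d. Suc i)"
      by (simp add: algebra_simps)
    then show ?thesis
      unfolding two_sum_Suc card_pairs using p2 by (simp add: diff_mult_distrib)
  qed
  \<comment> \<open>Comparing degrees in x_0. Inserted into the total degree equation, this gives r
    e d \<le> (p - 1) d (d + 1), hence the upper bound on r e that the order of vanishing
    requires.\<close>
  have "g * (r - 1) \<le> e * d"
    unfolding degree_first_root_delta[OF \<epsilon>, symmetric] D[symmetric] ev_det_cmat[OF comm_ring_hom_coeff_const]
    by (rule degree_det_cmat_le) simp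
  then have "r * (g * (r - 1)) \<le> r * (e * d)" by simp
  with eq have "d * (r * e) \<le> d * (Suc d * (?p - 1))"
    by (simp add: algebra_simps)
  then have upper: "r * e \<le> Suc d * (?p - 1)" using d by simp
  have "?p - 1 < 2 * e \<and> g \<le> 2 * e - (?p - 1)"
    using det_cmat_fpoly_order[OF lower upper e r _ g D] d by simp
  then show ?thesis
    using in_B_setI[OF r d p2 e _ _ lower upper eq] by blast
qed

text \<open>The quotient of the determinant by the power of \<delta> is fixed by the grading, hence
  constant, and it is nonzero because the determinant is.\<close>

lemma B_set_imp_det_eq_delta_power:
  assumes B: "(r, e, d) \<in> B_set CARD('p::prime_card)"
  obtains \<epsilon> :: "'p::prime_card mod_ring" where "\<epsilon> \<noteq> 0"
    "det (cmat CARD('p) d (fpoly r ^ e)) = Const \<epsilon> * delta r ^ (2 * e - (CARD('p) - 1))"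
proof -
  let ?p = "CARD('p)"
  let ?D = "det (cmat ?p d (fpoly r ^ e :: 'p mod_ring mpoly poly))"
  have p: "prime ?p" by (rule prime_card)
  have p2: "?p \<ge> 2" using p by (rule prime_ge_2_nat)
  note B = B_set_bounds[OF B p2]
  define g where "g = 2 * e - (?p - 1)"
  have "delta r ^ g dvd ?D"
    unfolding g_def
    by (rule delta_power_dvd, rule Var_diff_power_dvd_det[OF p]) (use B in simp_all)
  then obtain Q where Q: "?D = delta r ^ g * Q" by blast
  interpret h: comm_ring_hom "grade_hom :: 'p mod_ring mpoly \<Rightarrow> _"
    by (rule comm_ring_hom_grade_hom)
  interpret c: comm_ring_hom "\<lambda>x :: 'p mod_ring mpoly. [:x:]"
    by (rule comm_ring_hom_const_poly)
  have "?p * (2 * (\<Sum>i<d. Suc i)) + (2 * card (pairs r)) * g = 2 * (r * e * d) + 2 * (\<Sum>i<d. Suc i)"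
    unfolding two_sum_Suc card_pairs B(9) g_def using p2 by (cases ?p) simp_all
  then have exponent: "?p * (\<Sum>i<d. Suc i) + card (pairs r) * g = r * e * d + (\<Sum>i<d. Suc i)"
    by simp
  have "[:0, 1:] ^ (?p * (\<Sum>i<d. Suc i) + card (pairs r) * g) * ([:delta r:] ^ g * grade_hom Q) =
      [:0, 1:] ^ (?p * (\<Sum>i<d. Suc i)) * grade_hom ?D"
    unfolding Q h.hom_mult h.hom_power grade_hom_delta
    by (simp only: power_mult_distrib power_mult power_add mult.assoc)
  also have "\<dots> = [:0, 1:] ^ (r * e * d + (\<Sum>i<d. Suc i)) * [:?D:]"
    using p2 by (intro grade_hom_det) simp
  also have "[:?D:] = [:delta r:] ^ g * [:Q:]"
    unfolding Q c.hom_mult c.hom_power ..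
  finally have "[:0, 1:] ^ (r * e * d + (\<Sum>i<d. Suc i)) * [:delta r:] ^ g * grade_hom Q =
      [:0, 1:] ^ (r * e * d + (\<Sum>i<d. Suc i)) * [:delta r:] ^ g * [:Q:]"
    unfolding exponent mult.assoc .
  moreover have "[:0, 1:] ^ (r * e * d + (\<Sum>i<d. Suc i)) * [:delta r :: 'p mod_ring mpoly:] ^ g \<noteq> 0"
    using delta_neq_0[of r, where 'a = "'p mod_ring"] by simp
  ultimately have "grade_hom Q = [:Q:]"
    by (metis mult_left_cancel)
  then have "Q = Const (Poly_Mapping.lookup Q 0)"
    by (rule grade_hom_fixed_imp_Const)
  moreover have "Q \<noteq> 0"
    using det_cmat_fpoly_nonzero[OF B(7,8,5)] Q by auto
  ultimately show thesis
    using that[of "Poly_Mapping.lookup Q 0"] Q unfolding g_def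
    by (metis Const_def mult.commute single_zero)
qed

theorem theorem3:
  assumes "CARD('p::prime_card) < 200000"
  shows "A_set TYPE('p) = B_set CARD('p)"
proof (intro equalityI subsetI)
  have p: "CARD('p) \<ge> 2" using prime_card by (rule prime_ge_2_nat)
  then have Mmat: "Mmat CARD('p) d F = cmat CARD('p) d F" for d and F :: "'p mod_ring mpoly poly"
    by (simp add: Mmat_eq_cmat)
  fix x :: "nat \<times> nat \<times> nat"
  obtain r e d where x: "x = (r, e, d)" by (cases x)
  {
    assume "x \<in> A_set TYPE('p)"
    then show "x \<in> B_set CARD('p)"
      unfolding x A_set_def Mmat by (auto intro: det_eq_delta_power_imp_B_set)
  next
    assume "x \<in> B_set CARD('p)"
    then have B: "(r, e, d) \<in> B_set CARD('p)" by (simp add: x)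
    obtain \<epsilon> :: "'p mod_ring" where "\<epsilon> \<noteq> 0"
      "det (cmat CARD('p) d (fpoly r ^ e)) = Const \<epsilon> * delta r ^ (2 * e - (CARD('p) - 1))"
      using B by (rule B_set_imp_det_eq_delta_power)
    moreover have "2 * e - (CARD('p) - 1) > 0"
      using B_set_bounds(6)[OF B p] by simp
    ultimately show "x \<in> A_set TYPE('p)"
      unfolding x A_set_def Mmat using B_set_bounds(1-4)[OF B p] by blast
  }
qed

end
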